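(* Let $(a,b)\subset\mathbb{R}$ be a finite interval, $m,n\in\mathbb{N}$, $\varepsilon_0>0$. For each $\varepsilon\in[0,\varepsilon_0)$ let $A(\cdot;\varepsilon)\in (W^{n-1}_\infty)^{m\times m}$, $f(\cdot;\varepsilon)\in(W^{n-1}_\infty)^m$, $c(\varepsilon)\in\mathbb{C}^m$, and let $B(\varepsilon)\colon (W^n_\infty)^m\to\mathbb{C}^m$ be a bounded linear operator; let $L(\varepsilon)y:=y'+A(\cdot;\varepsilon)y$ and consider the operator $(L(\varepsilon),B(\varepsilon))\colon (W^n_\infty)^m\to (W^{n-1}_\infty)^m\times\mathbb{C}^m$, $y\mapsto(L(\varepsilon)y,B(\varepsilon)y)$. Assume the problem $L(0)y=0$ on $(a,b)$, $B(0)y=0$ has only the trivial solution in $(W^n_\infty)^m$, and that as $\varepsilon\to0+$: 1) $\|A(\cdot;\varepsilon)-A(\cdot;0)\|_{n-1,\infty}\to0$; 2) $B(\varepsilon)y\to B(0)y$ in $\mathbb{C}^m$ for every $y\in(W^n_\infty)^m$. Then for all sufficiently small $\varepsilon>0$ the operator $(L(\varepsilon),B(\varepsilon))$ is invertible. If in addition 3) $\|f(\cdot;\varepsilon)-f(\cdot;0)\|_{n-1,\infty}\to0$ and $c(\varepsilon)\to c(0)$ as $\varepsilon\to0+$, then the solutions $y(\cdot;\varepsilon)$ of $L(\varepsilon)y=f(\cdot;\varepsilon)$, $B(\varepsilon)y=c(\varepsilon)$ satisfy $\|y(\cdot;\varepsilon)-y(\cdot;0)\|_{n,\infty}\to0$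 as $\varepsilon\to0+$.
   Context: For an integer $k\ge0$, $W^k_\infty=W^k_\infty([a,b];\mathbb{C})$ is the Sobolev space of complex functions on $[a,b]$ whose derivatives up to order $k$ are essentially bounded, with norm $\|y\|_{k,\infty}=\sum_{j=0}^k\|y^{(j)}\|_{L_\infty}$; $W^0_\infty=L_\infty$. $(W^k_\infty)^m$, $(W^k_\infty)^{m\times m}$ denote vector/matrix functions with components in $W^k_\infty$, normed componentwise. A solution of $L(\varepsilon)y=f$, $B(\varepsilon)y=c$ is a $y\in(W^n_\infty)^m$ satisfying $y'+A(\cdot;\varepsilon)y=f$ a.e. on $(a,b)$ and $B(\varepsilon)y=c$. *)

theory Defs
  imports "HOL-Analysis.Analysis"
begin

text \<open>Functions on [a,b] are represented by total functions real => _ ; only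
their values on [a,b] matter.  Derivatives are taken within [a,b].\<close>

fun sob_deriv :: "real \<Rightarrow> real \<Rightarrow> nat \<Rightarrow> (real \<Rightarrow> complex) \<Rightarrow> real \<Rightarrow> complex" where
  "sob_deriv a b 0 y = y"
| "sob_deriv a b (Suc j) y = (\<lambda>x. vector_derivative (sob_deriv a b j y) (at x within {a..b}))"

definition Linf_norm :: "real \<Rightarrow> real \<Rightarrow> (real \<Rightarrow> 'v::real_normed_vector) \<Rightarrow> real" where
  "Linf_norm a b g = Inf {K. AE x in lebesgue. x \<in> {a..b} \<longrightarrow> norm (g x) \<le> K}"

definition ess_bounded :: "real \<Rightarrow> real \<Rightarrow> (real \<Rightarrow> 'v::real_normed_vector) \<Rightarrow> bool" where
  "ess_bounded a b g \<longleftrightarrow> (\<exists>K. AE x in lebesgue. x \<in> {a..b} \<longrightarrow> norm (g x) \<le> K)"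

text \<open>Scalar Sobolev space W^k_infty([a,b];C): all derivatives up to order k are
measurable and essentially bounded, and each derivative of order < k is the
indefinite integral of the next one (absolute continuity).\<close>
definition W_inf :: "real \<Rightarrow> real \<Rightarrow> nat \<Rightarrow> (real \<Rightarrow> complex) \<Rightarrow> bool" where
  "W_inf a b k y \<longleftrightarrow>
     (\<forall>j\<le>k. sob_deriv a b j y \<in> borel_measurable (restrict_space lebesgue {a..b})
            \<and> ess_bounded a b (sob_deriv a b j y))
   \<and> (\<forall>j<k. \<forall>x\<in>{a..b}. sob_deriv a b j y x
            = sob_deriv a b j y a + integral {a..x} (sob_deriv a b (Suc j) y))"

definition W_norm :: "real \<Rightarrow> real \<Rightarrow> nat \<Rightarrow> (real \<Rightarrow> complex) \<Rightarrow> real" where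
  "W_norm a b k y = (\<Sum>j\<le>k. Linf_norm a b (sob_deriv a b j y))"

definition vW_inf :: "real \<Rightarrow> real \<Rightarrow> nat \<Rightarrow> (real \<Rightarrow> complex ^ 'm) \<Rightarrow> bool" where
  "vW_inf a b k y \<longleftrightarrow> (\<forall>i. W_inf a b k (\<lambda>x. y x $ i))"

definition vW_norm :: "real \<Rightarrow> real \<Rightarrow> nat \<Rightarrow> (real \<Rightarrow> complex ^ 'm) \<Rightarrow> real" where
  "vW_norm a b k y = (\<Sum>i\<in>UNIV. W_norm a b k (\<lambda>x. y x $ i))"

definition mW_inf :: "real \<Rightarrow> real \<Rightarrow> nat \<Rightarrow> (real \<Rightarrow> complex ^ 'm ^ 'm) \<Rightarrow> bool" where
  "mW_inf a b k A \<longleftrightarrow> (\<forall>i j. W_inf a b k (\<lambda>x. A x $ i $ j))"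

definition mW_norm :: "real \<Rightarrow> real \<Rightarrow> nat \<Rightarrow> (real \<Rightarrow> complex ^ 'm ^ 'm) \<Rightarrow> real" where
  "mW_norm a b k A = (\<Sum>i\<in>UNIV. \<Sum>j\<in>UNIV. W_norm a b k (\<lambda>x. A x $ i $ j))"

definition solves_ode :: "real \<Rightarrow> real \<Rightarrow> (real \<Rightarrow> complex ^ 'm ^ 'm) \<Rightarrow> (real \<Rightarrow> complex ^ 'm)
    \<Rightarrow> (real \<Rightarrow> complex ^ 'm) \<Rightarrow> bool" where
  "solves_ode a b A f y \<longleftrightarrow>
     (AE x in lebesgue. x \<in> {a<..<b} \<longrightarrow> (y has_vector_derivative (f x - A x *v y x)) (at x))"

definition bounded_linear_W :: "real \<Rightarrow> real \<Rightarrow> nat \<Rightarrow> ((real \<Rightarrow> complex ^ 'm) \<Rightarrow> complex ^ 'm) \<Rightarrow> bool" where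
  "bounded_linear_W a b n B \<longleftrightarrow>
     (\<forall>y z. vW_inf a b n y \<longrightarrow> vW_inf a b n z \<longrightarrow> B (\<lambda>x. y x + z x) = B y + B z)
   \<and> (\<forall>s y. vW_inf a b n y \<longrightarrow> B (\<lambda>x. s *s y x) = s *s B y)
   \<and> (\<exists>K. \<forall>y. vW_inf a b n y \<longrightarrow> norm (B y) \<le> K * vW_norm a b n y)"

definition LB_invertible :: "real \<Rightarrow> real \<Rightarrow> nat \<Rightarrow> (real \<Rightarrow> complex ^ 'm ^ 'm)
    \<Rightarrow> ((real \<Rightarrow> complex ^ 'm) \<Rightarrow> complex ^ 'm) \<Rightarrow> bool" where
  "LB_invertible a b n A B \<longleftrightarrow>
     (\<forall>f c. vW_inf a b (n - 1) f \<longrightarrow> (\<exists>y. vW_inf a b n y \<and> solves_ode a b A f y \<and> B y = c))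
   \<and> (\<forall>y. vW_inf a b n y \<and> solves_ode a b A (\<lambda>_. 0) y \<and> B y = 0 \<longrightarrow> (\<forall>x\<in>{a..b}. y x = 0))
   \<and> (\<exists>K. \<forall>f c y. vW_inf a b (n - 1) f \<and> vW_inf a b n y \<and> solves_ode a b A f y \<and> B y = c
          \<longrightarrow> vW_norm a b n y \<le> K * (vW_norm a b (n - 1) f + norm c))"

end

theory Submission
  imports Defs
begin

text \<open>Let \<open>y\<close> be arbitrary and let \<open>w\<close> be the solution of the homogeneous limit equation with
  \<open>w a = y a\<close>. Gronwall's inequality bounds \<open>y - w\<close> in \<open>W^n\<close> by the residual of \<open>y\<close> under \<open>L(0)\<close>,
  hence by \<open>L(\<epsilon>) y\<close> up to an error that condition 1 makes absorbable. Uniqueness for the limit problem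
  bounds \<open>y a\<close> by \<open>B(0) w\<close>. Since \<open>w\<close> ranges over a finite-dimensional space, strong convergence
  replaces \<open>B(0) w\<close> by \<open>B(\<epsilon>) w\<close>, and the uniform boundedness principle controls \<open>B(\<epsilon>) (y - w)\<close>.
  The resulting a priori estimate \<open>norm y \<le> K (norm (L(\<epsilon>) y) + norm (B(\<epsilon>) y))\<close> is uniform in small
  \<open>\<epsilon>\<close>. It gives injectivity, thus surjectivity by a dimension count, and applied to
  \<open>y(\<epsilon>) - y(0)\<close> it gives the convergence.\<close>

section \<open>Differentiation of indefinite integrals\<close>

text \<open>Norm convergence is needed only on the homogeneous solutions of the limit equation,
  which are determined by their value at \<open>a\<close>. On \<open>y - w\<close>, which vanishes
  at \<open>a\<close>, a uniform bound suffices, because the data already control that part up to a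
  small multiple of the norm of \<open>y\<close>. Taking \<open>w\<close> from the limit equation
  and not from the \<epsilon>-equation keeps the finite-dimensional space fixed. The encoding shapes
  the preparations. An equation holding almost everywhere has to be exchanged for an integral
  equation and back, which needs Lebesgue's differentiation theorem; closure of \<open>W_inf\<close>
  under products needs the fundamental theorem for Lipschitz functions. Moreover
  \<open>W_inf\<close> is a predicate on total functions and carries only a seminorm, so
  completeness is phrased by absolutely summable series, and equality of functions means equality on
  \<open>{a..b}\<close>.\<close>

text \<open>Identifies the error of one term in Henstock's lemma, for an interval tagged at one of
  its ends, with the error of a difference quotient; the minimum and maximum cover both positions of
  \<open>u\<close> relative to \<open>x\<close>.\<close>

lemma indefinite_integral_increment:
  fixes f :: "real \<Rightarrow> 'e::banach"
  assumes f: "f integrable_on {a..b}" and x: "x \<in> {a..b}" and u: "u \<in> {a..b}"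
  shows "norm (measure lborel {min x u..max x u} *\<^sub>R f x - integral {min x u..max x u} f)
       = norm (integral {a..u} f - integral {a..x} f - (u - x) *\<^sub>R f x)"
proof (cases "x \<le> u")
  case True
  have "integral {a..x} f + integral {x..u} f = integral {a..u} f"
    by (rule Henstock_Kurzweil_Integration.integral_combine) (use True x u f in \<open>auto intro: integrable_subinterval_real\<close>)
  then have "integral {a..u} f - integral {a..x} f - (u - x) *\<^sub>R f x = - ((u - x) *\<^sub>R f x - integral {x..u} f)"
    by (simp add: algebra_simps)
  then show ?thesis
    using True by (simp only: norm_minus_cancel) (simp add: min_def max_def)
next
  case False
  have "integral {a..u} f + integral {u..x} f = integral {a..x} f"
    by (rule Henstock_Kurzweil_Integration.integral_combine) (use False x u f in \<open>auto intro: integrable_subinterval_real\<close>)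
  then have "integral {a..u} f - integral {a..x} f - (u - x) *\<^sub>R f x = (x - u) *\<^sub>R f x - integral {u..x} f"
    by (simp add: algebra_simps)
  then show ?thesis
    using False by (simp add: min_def max_def)
qed

text \<open>The set where the difference quotients fail to approximate \<open>f x\<close> up to \<open>\<mu>\<close> is covered,
  via Vitali, by intervals for which Henstock's lemma controls the total error.\<close>

lemma negligible_bad_difference_quotient:
  fixes f :: "real \<Rightarrow> 'e::euclidean_space"
  assumes f: "f integrable_on {a..b}" and "\<mu> > 0"
  shows "negligible {x \<in> {a<..<b}. \<forall>d>0. \<exists>u\<in>{a<..<b}. \<bar>u - x\<bar> < d \<and>
     norm (integral {a..u} f - integral {a..x} f - (u - x) *\<^sub>R f x) > \<mu> * \<bar>u - x\<bar>}" (is "negligible ?E")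
  unfolding negligible_outer_le
proof (intro allI impI)
  fix e :: real assume "e > 0"
  let ?G = "\<lambda>x. integral {a..x} f"
  \<comment> \<open>The 10 is 2 times 5: a ball of radius \<open>r\<close> has length
    \<open>2 * r\<close>, and Vitali's lemma enlarges radii by the factor 5.\<close>
  have "e * \<mu> / 10 > 0" using \<open>e > 0\<close> \<open>\<mu> > 0\<close> by simp
  then obtain \<gamma> where "gauge \<gamma>" and \<gamma>:
     "\<And>p. \<lbrakk>p tagged_partial_division_of (cbox a b); \<gamma> fine p\<rbrakk> \<Longrightarrow>
             sum (\<lambda>(x,k). norm(measure lborel k *\<^sub>R f x - integral k f)) p < e * \<mu> / 10"
    using Henstock_lemma[of f a b "e * \<mu> / 10"] f by (auto simp: cbox_interval)
  \<comment> \<open>A bad point together with a witness \<open>u\<close>. The interval between them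
    lies in the ball about \<open>x\<close>, so disjoint balls yield disjoint intervals that are
    automatically fine for the gauge.\<close>
  define K where "K = {(x,u). x \<in> {a<..<b} \<and> u \<in> {a<..<b} \<and> cball x \<bar>u - x\<bar> \<subseteq> \<gamma> x \<and> u \<noteq> x
      \<and> norm (?G u - ?G x - (u - x) *\<^sub>R f x) > \<mu> * \<bar>u - x\<bar>}"
  define r :: "real \<times> real \<Rightarrow> real" where "r = (\<lambda>i. \<bar>snd i - fst i\<bar>)"
  have "?E \<subseteq> (\<Union>i\<in>K. cball (fst i) (r i))"
  proof
    fix x assume x: "x \<in> ?E"
    obtain d where d: "d > 0" "cball x d \<subseteq> \<gamma> x"
      using \<open>gauge \<gamma>\<close> by (meson gaugeD open_contains_cball)
    then obtain u where u: "u\<in>{a<..<b}" "\<bar>u - x\<bar> < d" "norm (?G u - ?G x - (u - x) *\<^sub>R f x) > \<mu> * \<bar>u - x\<bar>"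
      using x by blast
    have "cball x \<bar>u - x\<bar> \<subseteq> \<gamma> x"
      using d(2) u(2) by (meson less_imp_le order_trans subset_cball)
    then have "(x,u) \<in> K" using u x by (auto simp: K_def)
    then show "x \<in> (\<Union>i\<in>K. cball (fst i) (r i))"
      by (auto simp: r_def intro!: bexI[of _ "(x,u)"])
  qed
  moreover have "0 < r i \<and> r i \<le> b - a" if "i \<in> K" for i
    using that by (auto simp: K_def r_def)
  ultimately obtain C where C: "countable C" "C \<subseteq> K"
     "pairwise (\<lambda>i j. disjnt (cball (fst i) (r i)) (cball (fst j) (r j))) C"
     "?E \<subseteq> (\<Union>i\<in>C. cball (fst i) (5 * r i))"
    by (rule Vitali_covering_lemma_cballs)
  \<comment> \<open>Henstock's lemma speaks about finite partial divisions only; the bound passes to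
    the countable union because it is the same for every finite subfamily.\<close>
  have bound: "measure lebesgue (\<Union>i\<in>F. cball (fst i) (5 * r i)) \<le> e" if F: "F \<subseteq> C" "finite F" for F
  proof -
    define J where "J = (\<lambda>i::real\<times>real. {min (fst i) (snd i)..max (fst i) (snd i)})"
    define p where "p = (\<lambda>i. (fst i, J i)) ` F"
    have FK: "i \<in> K" if "i \<in> F" for i using that F C by auto
    have Jc: "J i \<subseteq> cball (fst i) (r i)" for i
      by (auto simp: J_def r_def dist_real_def)
    have disj: "J i \<inter> J j = {}" if "i \<in> F" "j \<in> F" "i \<noteq> j" for i j
      using C(3) F that Jc[of i] Jc[of j] unfolding pairwise_def disjnt_def by blast
    have Jne: "fst i \<in> J i" for i by (auto simp: J_def)
    \<comment> \<open>Each interval contains its tag and distinct intervals are disjoint, so the sum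
      over the division can be reindexed by \<open>F\<close>.\<close>
    have inj: "inj_on (\<lambda>i. (fst i, J i)) F"
    proof (rule inj_onI)
      fix i j assume "i \<in> F" "j \<in> F" "(fst i, J i) = (fst j, J j)"
      then show "i = j" using disj[of i j] Jne[of i] by auto
    qed
    have "p tagged_partial_division_of (cbox a b)"
      unfolding tagged_partial_division_of_def p_def
    proof (intro conjI allI impI)
      show "finite ((\<lambda>i. (fst i, J i)) ` F)" using F by simp
    next
      fix x k assume "(x,k) \<in> (\<lambda>i. (fst i, J i)) ` F"
      then obtain i where i: "i \<in> F" "x = fst i" "k = J i" by auto
      then show "x \<in> k" using Jne by simp
      show "k \<subseteq> cbox a b" using FK[OF i(1)] i by (auto simp: K_def J_def)
      show "\<exists>a b. k = cbox a b" using i by (auto simp: J_def cbox_interval)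
    next
      fix x1 k1 x2 k2
      assume "(x1,k1) \<in> (\<lambda>i. (fst i, J i)) ` F \<and> (x2,k2) \<in> (\<lambda>i. (fst i, J i)) ` F \<and> (x1,k1) \<noteq> (x2,k2)"
      then obtain i j where "i \<in> F" "j \<in> F" "i \<noteq> j" "k1 = J i" "k2 = J j" by auto
      then show "interior k1 \<inter> interior k2 = {}"
        using disj[of i j] interior_subset[of k1] interior_subset[of k2] by blast
    qed
    moreover have "\<gamma> fine p"
      unfolding fine_def
    proof (clarsimp simp: p_def)
      fix x u t assume i: "(x,u) \<in> F" "t \<in> J (x,u)"
      then have "t \<in> cball x \<bar>u - x\<bar>" using Jc[of "(x,u)"] by (auto simp: r_def)
      then show "t \<in> \<gamma> x" using FK[OF i(1)] by (auto simp: K_def)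
    qed
    ultimately have "sum (\<lambda>(x,k). norm(measure lborel k *\<^sub>R f x - integral k f)) p < e * \<mu> / 10"
      by (rule \<gamma>)
    also have "sum (\<lambda>(x,k). norm(measure lborel k *\<^sub>R f x - integral k f)) p
       = (\<Sum>i\<in>F. norm (?G (snd i) - ?G (fst i) - (snd i - fst i) *\<^sub>R f (fst i)))"
      unfolding p_def sum.reindex[OF inj] o_def split_conv
    proof (rule sum.cong)
      fix i assume "i \<in> F"
      from FK[OF this] have "fst i \<in> {a..b}" "snd i \<in> {a..b}" by (auto simp: K_def)
      then show "norm (measure lborel (J i) *\<^sub>R f (fst i) - integral (J i) f)
         = norm (?G (snd i) - ?G (fst i) - (snd i - fst i) *\<^sub>R f (fst i))"
        unfolding J_def by (rule indefinite_integral_increment[OF f])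
    qed simp
    finally have *: "(\<Sum>i\<in>F. norm (?G (snd i) - ?G (fst i) - (snd i - fst i) *\<^sub>R f (fst i))) < e * \<mu> / 10" .
    have "(\<Sum>i\<in>F. \<mu> * r i) \<le> (\<Sum>i\<in>F. norm (?G (snd i) - ?G (fst i) - (snd i - fst i) *\<^sub>R f (fst i)))"
    proof (rule sum_mono)
      fix i assume "i \<in> F"
      from FK[OF this] show "\<mu> * r i \<le> norm (?G (snd i) - ?G (fst i) - (snd i - fst i) *\<^sub>R f (fst i))"
        by (auto simp: K_def r_def)
    qed
    with * have "(\<Sum>i\<in>F. \<mu> * r i) < e * \<mu> / 10" by simp
    then have s: "(\<Sum>i\<in>F. r i) < e / 10"
      using \<open>\<mu> > 0\<close> by (simp add: pos_less_divide_eq mult.commute flip: sum_distrib_left)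
    have "measure lebesgue (\<Union>i\<in>F. cball (fst i) (5 * r i)) \<le> (\<Sum>i\<in>F. measure lebesgue (cball (fst i) (5 * r i)))"
      by (rule measure_UNION_le) (use F in auto)
    also have "\<dots> = (\<Sum>i\<in>F. 10 * r i)"
      by (rule sum.cong) (auto simp: cball_eq_atLeastAtMost r_def)
    also have "\<dots> = 10 * (\<Sum>i\<in>F. r i)" by (rule sum_distrib_left[symmetric])
    also have "\<dots> \<le> e" using s by linarith
    finally show ?thesis .
  qed
  have "(\<Union>i\<in>C. cball (fst i) (5 * r i)) \<in> lmeasurable"
    by (rule fmeasurable_UN_bound[OF C(1) lmeasurable_cball bound])
  moreover have "measure lebesgue (\<Union>i\<in>C. cball (fst i) (5 * r i)) \<le> e"
    by (rule measure_UN_bound[OF C(1) lmeasurable_cball bound])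
  ultimately show "\<exists>T. ?E \<subseteq> T \<and> T \<in> lmeasurable \<and> measure lebesgue T \<le> e" using C(4) by blast
qed

text \<open>Lebesgue's differentiation theorem: the tolerances \<open>inverse (real (Suc k))\<close>
  suffice, so the exceptional points form a countable union of negligible sets.\<close>

theorem indefinite_integral_derivative_AE:
  fixes f :: "real \<Rightarrow> 'e::euclidean_space"
  assumes f: "f integrable_on {a..b}"
  shows "AE x in lebesgue. x \<in> {a<..<b} \<longrightarrow>
     ((\<lambda>u. integral {a..u} f) has_vector_derivative f x) (at x)"
proof -
  let ?G = "\<lambda>x. integral {a..x} f"
  define E where "E = (\<lambda>k. {x \<in> {a<..<b}. \<forall>d>0. \<exists>u\<in>{a<..<b}. \<bar>u - x\<bar> < d \<and>
     norm (?G u - ?G x - (u - x) *\<^sub>R f x) > inverse (real (Suc k)) * \<bar>u - x\<bar>})"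
  have "negligible (E k)" for k
    unfolding E_def by (rule negligible_bad_difference_quotient[OF f]) simp
  then have "negligible (\<Union>k. E k)"
    by (intro negligible_countable_Union) auto
  moreover have "(?G has_vector_derivative f x) (at x)" if x: "x \<in> {a<..<b}" "x \<notin> (\<Union>k. E k)" for x
    unfolding has_vector_derivative_def has_derivative_at_alt
  proof (intro conjI allI impI)
    fix e :: real assume "e > 0"
    then obtain k where k: "inverse (real (Suc k)) < e" using reals_Archimedean by blast
    have "x \<notin> E k" using x by auto
    then obtain d where d: "d > 0" "\<And>u. u\<in>{a<..<b} \<Longrightarrow> \<bar>u - x\<bar> < d \<Longrightarrow>
       norm (?G u - ?G x - (u - x) *\<^sub>R f x) \<le> inverse (real (Suc k)) * \<bar>u - x\<bar>"
      using x(1) unfolding E_def mem_Collect_eq not_less[symmetric] by blast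
    define d' where "d' = min d (min (x - a) (b - x))"
    show "\<exists>d>0. \<forall>y. norm (y - x) < d \<longrightarrow> norm (?G y - ?G x - (y - x) *\<^sub>R f x) \<le> e * norm (y - x)"
    proof (intro exI conjI allI impI)
      show "d' > 0" using d x by (simp add: d'_def)
      fix u assume u: "norm (u - x) < d'"
      then have "u\<in>{a<..<b}" "\<bar>u - x\<bar> < d" by (auto simp: d'_def)
      then have "norm (?G u - ?G x - (u - x) *\<^sub>R f x) \<le> inverse (real (Suc k)) * \<bar>u - x\<bar>" by (rule d)
      also have "\<dots> \<le> e * norm (u - x)" using k by (simp add: mult_right_mono)
      finally show "norm (?G u - ?G x - (u - x) *\<^sub>R f x) \<le> e * norm (u - x)" .
    qed
  qed (rule bounded_linear_scaleR_left)
  ultimately show ?thesis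
    by (intro AE_I'[of "\<Union>k. E k"]) (auto simp: negligible_iff_null_sets)
qed

text \<open>The fundamental theorem of calculus for Lipschitz functions: the difference quotients are
  uniformly bounded, so dominated convergence applies to their integrals, which telescope.\<close>

theorem lipschitz_has_integral_derivative_AE:
  fixes F f :: "real \<Rightarrow> 'e::euclidean_space"
  assumes ab: "a \<le> b" and lip: "L-lipschitz_on {a..b} F"
    and D: "AE x in lebesgue. x \<in> {a<..<b} \<longrightarrow> (F has_vector_derivative f x) (at x)"
  shows "(f has_integral (F b - F a)) {a..b}"
proof -
  obtain N0 where N0: "negligible N0" "\<And>x. x \<in> {a<..<b} \<Longrightarrow> x \<notin> N0 \<Longrightarrow> (F has_vector_derivative f x) (at x)"
    using D unfolding eventually_ae_filter by (auto simp: negligible_iff_null_sets)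
  define N where "N = N0 \<union> {a,b}"
  have N: "negligible N" unfolding N_def using N0 by (simp add: negligible_finite)
  \<comment> \<open>The constant extension beyond both ends keeps the Lipschitz constant and makes
    the quotient at \<open>x + h k\<close> meaningful up to \<open>x = b\<close>.\<close>
  define G where "G = (\<lambda>x. F (max a (min b x)))"
  have "L \<ge> 0" using lip by (rule lipschitz_on_nonneg)
  have GL: "norm (G x - G y) \<le> L * \<bar>x - y\<bar>" for x y
  proof -
    have "norm (G x - G y) \<le> L * norm (max a (min b x) - max a (min b y))"
      unfolding G_def by (rule lipschitz_on_normD[OF lip]) (use ab in auto)
    also have "\<dots> \<le> L * \<bar>x - y\<bar>" using \<open>L \<ge> 0\<close> by (intro mult_left_mono) auto
    finally show ?thesis .
  qed
  have "L-lipschitz_on UNIV G"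
    using \<open>L \<ge> 0\<close> GL by (intro lipschitz_onI) (auto simp: dist_norm)
  then have Gc: "continuous_on UNIV G" by (rule lipschitz_on_continuous_on)
  have Gi: "G integrable_on {c..d}" for c d
    by (intro integrable_continuous_real continuous_on_subset[OF Gc]) auto
  define h where "h = (\<lambda>k. inverse (real (Suc k)))"
  have h: "h k > 0" for k by (simp add: h_def)
  have h0: "h \<longlonglongrightarrow> 0" unfolding h_def by (rule LIMSEQ_inverse_real_of_nat)
  define \<phi> where "\<phi> = (\<lambda>k x. (G (x + h k) - G x) /\<^sub>R h k)"
  \<comment> \<open>Setting the quotients to 0 on \<open>N\<close> turns convergence almost
    everywhere into convergence at every point, as dominated convergence is applied in that
    form.\<close>
  define \<psi> where "\<psi> = (\<lambda>k x. if x \<in> N then 0 else \<phi> k x)"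
  have \<phi>i: "\<phi> k integrable_on {a..b}" for k
    unfolding \<phi>_def
    by (intro integrable_continuous_real continuous_intros continuous_on_compose2[OF Gc]) (auto intro: continuous_on_subset[OF Gc])
  have \<psi>i: "\<psi> k integrable_on {a..b}" for k
    by (rule integrable_spike[OF \<phi>i[of k] N]) (simp add: \<psi>_def)
  have bd: "norm (\<psi> k x) \<le> L" for k x
  proof -
    have "norm (\<phi> k x) = norm (G (x + h k) - G x) / h k"
      using h[of k] by (simp add: \<phi>_def divide_inverse mult.commute)
    also have "\<dots> \<le> L" using GL[of "x + h k" x] h[of k] by (simp add: field_simps)
    finally show ?thesis using \<open>L \<ge> 0\<close> by (simp add: \<psi>_def)
  qed
  define g where "g = (\<lambda>x. if x \<in> N then 0 else f x)"
  have lim: "(\<lambda>k. \<psi> k x) \<longlonglongrightarrow> g x" if x: "x \<in> {a..b}" for x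
  proof (cases "x \<in> N")
    case False
    then have x': "x \<in> {a<..<b}" using x by (force simp: N_def)
    have "(F has_vector_derivative f x) (at x)" using N0(2)[OF x'] False by (simp add: N_def)
    then have "(G has_vector_derivative f x) (at x)"
      by (rule has_vector_derivative_transform_within_open[of _ _ _ "{a<..<b}"]) (use x' in \<open>auto simp: G_def\<close>)
    then have lim0: "((\<lambda>t. norm (G (x + t) - G x - t *\<^sub>R f x) / norm t) \<longlongrightarrow> 0) (at 0)"
      by (simp add: has_vector_derivative_def has_derivative_at)
    have "filterlim h (at 0) sequentially"
      using h0 h by (auto simp: filterlim_at less_imp_neq[symmetric])
    from filterlim_compose[OF lim0 this]
    have "(\<lambda>k. norm (G (x + h k) - G x - h k *\<^sub>R f x) / norm (h k)) \<longlonglongrightarrow> 0" .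
    moreover have "norm (G (x + h k) - G x - h k *\<^sub>R f x) / norm (h k) = norm (\<psi> k x - g x)" for k
    proof -
      have "\<psi> k x - g x = (G (x + h k) - G x - h k *\<^sub>R f x) /\<^sub>R h k"
        using False h[of k] by (simp add: \<psi>_def \<phi>_def g_def algebra_simps)
      then show ?thesis using h[of k] by (simp add: divide_inverse mult.commute)
    qed
    ultimately show ?thesis
      by (simp add: tendsto_norm_zero_iff LIM_zero_cancel)
  qed (simp add: \<psi>_def g_def)
  have conv: "(\<lambda>k. integral {a..b} (\<psi> k)) \<longlonglongrightarrow> integral {a..b} g" and gi: "g integrable_on {a..b}"
    using dominated_convergence[OF \<psi>i _ bd lim] by auto
  \<comment> \<open>After the shift by \<open>h k\<close> everything cancels except two integrals
    over intervals of length \<open>h k\<close> at the ends, whose averages tend to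
    \<open>G b\<close> and \<open>G a\<close>.\<close>
  have int\<phi>: "integral {a..b} (\<psi> k) = (integral {b..b + h k} G - integral {a..a + h k} G) /\<^sub>R h k" for k
  proof -
    have "integral {a..b} (\<psi> k) = integral {a..b} (\<phi> k)"
      by (rule integral_spike[OF N]) (simp add: \<psi>_def)
    also have "\<dots> = (integral {a..b} (\<lambda>x. G (x + h k)) - integral {a..b} G) /\<^sub>R h k"
      unfolding \<phi>_def using Gi
      by (subst integral_cmul, subst integral_diff) (auto intro!: integrable_continuous_real continuous_on_compose2[OF Gc] continuous_intros)
    also have "integral {a..b} (\<lambda>x. G (x + h k)) = integral {a + h k..b + h k} G"
      using integral_shift_Icc_real[of a b G "h k"] by (simp add: o_def add.commute)
    also have "integral {a + h k..b + h k} G - integral {a..b} G = integral {b..b + h k} G - integral {a..a + h k} G"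
      using Henstock_Kurzweil_Integration.integral_combine[of a b "b + h k" G] Henstock_Kurzweil_Integration.integral_combine[of a "a + h k" "b + h k" G] Gi ab h[of k]
      by (simp add: algebra_simps)
    finally show ?thesis .
  qed
  have est: "norm (integral {c..c + h k} G /\<^sub>R h k - G c) \<le> L * h k" for c k
  proof -
    have "integral {c..c + h k} G - h k *\<^sub>R G c = integral {c..c + h k} (\<lambda>x. G x - G c)"
      using h[of k] Gi by (subst integral_diff) auto
    also have "norm \<dots> \<le> integral {c..c + h k} (\<lambda>x. L * h k)"
    proof (rule integral_norm_bound_integral)
      fix x assume "x \<in> {c..c + h k}"
      then show "norm (G x - G c) \<le> L * h k"
        using GL[of x c] \<open>L \<ge> 0\<close> by (smt (verit) atLeastAtMost_iff mult_left_mono)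
    qed (use Gi in \<open>auto intro!: integrable_diff\<close>)
    also have "\<dots> = h k * (L * h k)" using h[of k] by simp
    finally have *: "norm (integral {c..c + h k} G - h k *\<^sub>R G c) \<le> h k * (L * h k)" .
    have "integral {c..c + h k} G /\<^sub>R h k - G c = (integral {c..c + h k} G - h k *\<^sub>R G c) /\<^sub>R h k"
      using h[of k] by (simp add: algebra_simps)
    then have "norm (integral {c..c + h k} G /\<^sub>R h k - G c) = norm (integral {c..c + h k} G - h k *\<^sub>R G c) / h k"
      using h[of k] by (simp add: divide_inverse mult.commute)
    also have "\<dots> \<le> L * h k" using * h[of k] by (simp add: pos_divide_le_eq mult_ac)
    finally show ?thesis .
  qed
  have "(\<lambda>k. integral {c..c + h k} G /\<^sub>R h k) \<longlonglongrightarrow> G c" for c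
  proof (rule LIM_zero_cancel, rule Lim_null_comparison)
    show "\<forall>\<^sub>F k in sequentially. norm (integral {c..c + h k} G /\<^sub>R h k - G c) \<le> L * h k"
      using est by simp
    show "(\<lambda>k. L * h k) \<longlonglongrightarrow> 0" using tendsto_mult_right_zero[OF h0] by simp
  qed
  then have "(\<lambda>k. integral {b..b + h k} G /\<^sub>R h k - integral {a..a + h k} G /\<^sub>R h k) \<longlonglongrightarrow> G b - G a"
    by (intro tendsto_diff)
  then have "(\<lambda>k. integral {a..b} (\<psi> k)) \<longlonglongrightarrow> G b - G a"
    unfolding int\<phi> by (simp add: scaleR_diff_right)
  then have "integral {a..b} g = F b - F a"
    using LIMSEQ_unique[OF conv] ab by (auto simp: G_def)
  then have "(g has_integral (F b - F a)) {a..b}" using gi by (simp add: has_integral_iff)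
  then show ?thesis
    by (rule has_integral_spike[OF N, rotated]) (simp add: g_def)
qed

section \<open>Sobolev functions on a compact interval\<close>

lemma norm_le_sum_nth: "norm (v :: complex ^ 'm) \<le> (\<Sum>i\<in>UNIV. norm (v $ i))"
  unfolding norm_vec_def by (rule L2_set_le_sum) simp

lemma norm_matvec_le:
  "norm ((A :: complex ^ 'm ^ 'm) *v v) \<le> (\<Sum>i\<in>UNIV. \<Sum>j\<in>UNIV. norm (A $ i $ j)) * norm v"
proof -
  have "norm (A *v v) \<le> (\<Sum>i\<in>UNIV. norm ((A *v v) $ i))" by (rule norm_le_sum_nth)
  also have "\<dots> \<le> (\<Sum>i\<in>UNIV. \<Sum>j\<in>UNIV. norm (A $ i $ j) * norm v)"
  proof (rule sum_mono)
    fix i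
    have "norm ((A *v v) $ i) \<le> (\<Sum>j\<in>UNIV. norm (A $ i $ j * v $ j))"
      unfolding matrix_vector_mult_def vec_lambda_beta by (rule norm_sum)
    also have "\<dots> \<le> (\<Sum>j\<in>UNIV. norm (A $ i $ j) * norm v)"
      by (rule sum_mono) (simp add: norm_mult mult_left_mono Finite_Cartesian_Product.norm_nth_le)
    finally show "norm ((A *v v) $ i) \<le> (\<Sum>j\<in>UNIV. norm (A $ i $ j) * norm v)" .
  qed
  finally show ?thesis by (simp add: sum_distrib_right)
qed

lemma matvec_smult: "(A :: complex ^ 'm ^ 'm) *v (s *s v) = s *s (A *v v)"
  by (simp add: vec_eq_iff matrix_vector_mult_def sum_distrib_left mult_ac)

lemma norm_smult: "norm (s *s (v :: complex ^ 'm)) = norm s * norm v"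
  by (simp add: norm_vec_def norm_mult L2_set_right_distrib)

text \<open>Allows the sign of a step in the gliding hump to be chosen so that earlier steps do not
  cancel it.\<close>

lemma norm_add_or_diff:
  fixes v w :: "'v::real_normed_vector"
  shows "norm w \<le> norm (v + w) \<or> norm w \<le> norm (v - w)"
proof -
  have "2 * norm w = norm ((v + w) - (v - w))" by (simp flip: scaleR_2)
  also have "\<dots> \<le> norm (v + w) + norm (v - w)" by (rule norm_triangle_ineq4)
  finally show ?thesis by linarith
qed

declare sob_deriv.simps(2) [simp del]

locale compact_interval =
  fixes a b :: real
  assumes ab: "a < b"
begin

section \<open>Statements almost everywhere and the essential supremum\<close>

abbreviation AEI :: "(real \<Rightarrow> bool) \<Rightarrow> bool" where
  "AEI P \<equiv> (AE x in lebesgue. x \<in> {a..b} \<longrightarrow> P x)"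

abbreviation "Linf \<equiv> Linf_norm a b"
abbreviation "W \<equiv> W_inf a b"
abbreviation "N \<equiv> W_norm a b"

text \<open>The interval has positive measure because \<open>a < b\<close>. This extracts
  unconditional facts from bounds almost everywhere; in particular essential bounds are nonnegative,
  so the infimum in \<open>Linf_norm\<close> is bounded below.\<close>

lemma AEI_const: "AEI (\<lambda>_. P) \<longleftrightarrow> P"
proof
  assume "AEI (\<lambda>_. P)"
  show P
  proof (rule ccontr)
    assume "\<not> P"
    with \<open>AEI (\<lambda>_. P)\<close> have "AE x in lebesgue. x \<notin> {a..b}" by simp
    then have "negligible {a..b}"
      by (simp add: negligible_iff_null_sets AE_iff_null_sets del: atLeastAtMost_iff)
    then show False
      using ab open_not_negligible[of "{a<..<b}"] negligible_subset[of "{a..b}" "{a<..<b}"]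
      by (auto simp: greaterThanLessThan_subseteq_atLeastAtMost_iff)
  qed
qed simp

lemma AEI_open: "(AE x in lebesgue. x \<in> {a<..<b} \<longrightarrow> P x) \<Longrightarrow> AEI P"
proof -
  assume *: "AE x in lebesgue. x \<in> {a<..<b} \<longrightarrow> P x"
  have "AE x in lebesgue. x \<notin> {a,b}"
    by (subst AE_iff_null_sets[symmetric]) (auto simp: negligible_iff_null_sets[symmetric] negligible_finite)
  with * show ?thesis by eventually_elim force
qed

lemma AEI_negligible:
  assumes "AEI P"
  obtains S where "negligible S" "\<And>x. x \<in> {a..b} - S \<Longrightarrow> P x"
  using assms unfolding eventually_ae_filter by (auto simp: negligible_iff_null_sets)

text \<open>Rests on completeness of Lebesgue measure; extension by 0 moves the statement from the
  interval to the whole line.\<close>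

lemma measurable_cong_AEI:
  fixes u v :: "real \<Rightarrow> 'e::euclidean_space"
  assumes u: "u \<in> borel_measurable (lebesgue_on {a..b})" and ae: "AEI (\<lambda>x. u x = v x)"
  shows "v \<in> borel_measurable (lebesgue_on {a..b})"
proof -
  have "(\<lambda>x. if x \<in> {a..b} then u x else 0) \<in> borel_measurable lebesgue"
    using u by (subst borel_measurable_if) auto
  moreover have "AE x in lebesgue. (if x \<in> {a..b} then u x else 0) = (if x \<in> {a..b} then v x else 0)"
    using ae by eventually_elim auto
  ultimately have "(\<lambda>x. if x \<in> {a..b} then v x else 0) \<in> borel_measurable lebesgue"
    by (rule borel_measurable_AE)
  then show ?thesis by (subst (asm) borel_measurable_if) auto
qed

lemma AEI_norm_le_nonneg:
  fixes g :: "real \<Rightarrow> 'v::real_normed_vector"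
  shows "AEI (\<lambda>x. norm (g x) \<le> K) \<Longrightarrow> 0 \<le> K"
proof (rule ccontr)
  assume *: "AEI (\<lambda>x. norm (g x) \<le> K)" "\<not> 0 \<le> K"
  then have "AEI (\<lambda>x. False)"
    by (elim eventually_mono) (meson norm_ge_zero order_trans)
  then show False by (simp only: AEI_const)
qed

lemma Linf_nonneg: "ess_bounded a b g \<Longrightarrow> 0 \<le> Linf g"
  unfolding Linf_norm_def ess_bounded_def by (rule cInf_greatest) (use AEI_norm_le_nonneg in auto)

lemma Linf_le: "AEI (\<lambda>x. norm (g x) \<le> K) \<Longrightarrow> Linf g \<le> K"
  unfolding Linf_norm_def by (rule cInf_lower) (auto intro!: bdd_belowI[of _ 0] AEI_norm_le_nonneg)

text \<open>The infimum is attained: the bounds exceeding it by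
  \<open>inverse (real (Suc k))\<close> hold simultaneously off one null set.\<close>

lemma Linf_AE:
  assumes "ess_bounded a b g"
  shows "AEI (\<lambda>x. norm (g x) \<le> Linf g)"
proof -
  have "AEI (\<lambda>x. norm (g x) \<le> Linf g + inverse (real (Suc k)))" for k
  proof -
    have "Linf g < Linf g + inverse (real (Suc k))" by simp
    moreover have "{K. AEI (\<lambda>x. norm (g x) \<le> K)} \<noteq> {}"
      using assms by (auto simp: ess_bounded_def)
    ultimately obtain K where K: "AEI (\<lambda>x. norm (g x) \<le> K)" "K < Linf g + inverse (real (Suc k))"
      unfolding Linf_norm_def using cInf_lessD by (metis (no_types, lifting) mem_Collect_eq)
    from K(1) show ?thesis by eventually_elim (use K(2) in auto)
  qed
  then have "AE x in lebesgue. \<forall>k. x \<in> {a..b} \<longrightarrow> norm (g x) \<le> Linf g + inverse (real (Suc k))"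
    by (subst AE_all_countable) auto
  then show ?thesis
  proof eventually_elim
    case (elim x)
    show ?case
    proof
      assume "x \<in> {a..b}"
      have "(\<lambda>k. Linf g + inverse (real (Suc k))) \<longlonglongrightarrow> Linf g + 0"
        by (intro tendsto_intros LIMSEQ_inverse_real_of_nat)
      then show "norm (g x) \<le> Linf g"
        using elim \<open>x \<in> {a..b}\<close> by (intro LIMSEQ_le_const[of _ "Linf g"]) auto
    qed
  qed
qed

lemma ess_bounded_cong: "AEI (\<lambda>x. u x = v x) \<Longrightarrow> ess_bounded a b u \<Longrightarrow> ess_bounded a b v"
  unfolding ess_bounded_def
proof safe
  fix K assume "AEI (\<lambda>x. u x = v x)" "AEI (\<lambda>x. norm (u x) \<le> K)"
  then have "AEI (\<lambda>x. norm (v x) \<le> K)" by eventually_elim auto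
  then show "\<exists>K. AEI (\<lambda>x. norm (v x) \<le> K)" ..
qed

lemma Linf_cong: "AEI (\<lambda>x. u x = v x) \<Longrightarrow> Linf u = Linf v"
proof -
  assume ae: "AEI (\<lambda>x. u x = v x)"
  have "AEI (\<lambda>x. norm (u x) \<le> K) \<longleftrightarrow> AEI (\<lambda>x. norm (v x) \<le> K)" for K
    using ae by (intro eventually_cong[OF ae]) auto
  then show ?thesis by (simp add: Linf_norm_def)
qed

section \<open>Sobolev functions by recursion on the order\<close>

definition wderiv :: "(real \<Rightarrow> complex) \<Rightarrow> real \<Rightarrow> complex" where
  "wderiv y = (\<lambda>x. vector_derivative y (at x within {a..b}))"

text \<open>\<open>sob_deriv\<close> adds derivatives at the outer end. Peeling off the innermost
  one instead reduces order \<open>Suc n\<close> of \<open>u\<close> to order \<open>n\<close> of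
  \<open>wderiv u\<close>, the form in which the inductions on the order run.\<close>

lemma sob_deriv_Suc_wderiv: "sob_deriv a b (Suc n) y = sob_deriv a b n (wderiv y)"
  by (induction n) (simp_all add: wderiv_def sob_deriv.simps(2))

lemma W_0: "W 0 u \<longleftrightarrow> u \<in> borel_measurable (lebesgue_on {a..b}) \<and> ess_bounded a b u"
  by (simp add: W_inf_def)

lemma W_Suc: "W (Suc n) u \<longleftrightarrow> W 0 u \<and> W n (wderiv u) \<and> (\<forall>x\<in>{a..b}. u x = u a + integral {a..x} (wderiv u))"
proof -
  have 1: "(\<forall>j\<le>Suc n. P j) \<longleftrightarrow> P 0 \<and> (\<forall>j\<le>n. P (Suc j))" for P :: "nat \<Rightarrow> bool"
    by (metis Suc_le_mono le0 not0_implies_Suc)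
  have 2: "(\<forall>j<Suc n. P j) \<longleftrightarrow> P 0 \<and> (\<forall>j<n. P (Suc j))" for P :: "nat \<Rightarrow> bool"
    by (metis All_less_Suc2)
  show ?thesis
    unfolding W_inf_def 1 2 unfolding sob_deriv_Suc_wderiv by (auto)
qed

lemma W_Suc_D:
  assumes "W (Suc n) u"
  shows "W 0 u" "W n (wderiv u)" "\<And>x. x \<in> {a..b} \<Longrightarrow> u x = u a + integral {a..x} (wderiv u)"
  using assms unfolding W_Suc by blast+

lemma N_0: "N 0 u = Linf u"
  by (simp add: W_norm_def)

lemma N_Suc: "N (Suc n) u = Linf u + N n (wderiv u)"
  unfolding W_norm_def sum.atMost_Suc_shift sob_deriv_Suc_wderiv by simp

lemma W_mono: "m \<le> n \<Longrightarrow> W n u \<Longrightarrow> W m u"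
  unfolding W_inf_def by (meson le_trans less_le_trans)

lemma W_imp_ess_bounded: "W n u \<Longrightarrow> ess_bounded a b u"
  using W_mono[of 0 n u] by (simp add: W_0)

lemma W_imp_measurable: "W n u \<Longrightarrow> u \<in> borel_measurable (lebesgue_on {a..b})"
  using W_mono[of 0 n u] by (simp add: W_0)

lemma N_mono: "m \<le> n \<Longrightarrow> W n u \<Longrightarrow> N m u \<le> N n u"
  unfolding W_norm_def by (rule sum_mono2) (auto intro!: Linf_nonneg simp: W_inf_def)

lemma N_nonneg: "W n u \<Longrightarrow> 0 \<le> N n u"
  unfolding W_norm_def by (rule sum_nonneg) (auto intro!: Linf_nonneg simp: W_inf_def)

lemma Linf_le_N: "W n u \<Longrightarrow> Linf u \<le> N n u"
  using N_mono[of 0 n u] by (simp add: N_0)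

lemma W_AE_bound: "W n u \<Longrightarrow> AEI (\<lambda>x. norm (u x) \<le> N n u)"
proof -
  assume u: "W n u"
  show ?thesis using Linf_AE[OF W_imp_ess_bounded[OF u]]
    by eventually_elim (use Linf_le_N[OF u] in auto)
qed

text \<open>Replacing the values above the essential bound by 0 gives a function that is bounded
  everywhere and differs only on a null set.\<close>

lemma bounded_measurable_integrable:
  fixes g :: "real \<Rightarrow> 'e::euclidean_space"
  assumes g: "g \<in> borel_measurable (lebesgue_on {a..b})" and K: "AEI (\<lambda>x. norm (g x) \<le> K)"
  shows "g integrable_on {a..b}"
proof -
  define g' where "g' = (\<lambda>x. if norm (g x) \<le> K then g x else 0)"
  have ae: "AEI (\<lambda>x. g x = g' x)" using K by eventually_elim (simp add: g'_def)
  have "K \<ge> 0" using K by (rule AEI_norm_le_nonneg)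
  have "g' integrable_on {a..b}"
    by (rule measurable_bounded_by_integrable_imp_integrable[of _ _ "\<lambda>_. K"])
      (use measurable_cong_AEI[OF g ae] \<open>K \<ge> 0\<close> in \<open>auto simp: g'_def\<close>)
  moreover obtain S where "negligible S" "\<And>x. x \<in> {a..b} - S \<Longrightarrow> g x = g' x"
    by (auto intro: AEI_negligible[OF ae])
  ultimately show ?thesis by (metis integrable_spike)
qed

lemma norm_integral_le_AEI:
  fixes g :: "real \<Rightarrow> 'e::euclidean_space"
  assumes gi: "g integrable_on {c..d}" and le: "AEI (\<lambda>x. norm (g x) \<le> h x)"
    and h: "h integrable_on {c..d}" and sub: "a \<le> c" "d \<le> b"
  shows "norm (integral {c..d} g) \<le> integral {c..d} h"
proof -
  obtain S where S: "negligible S" "\<And>x. x \<in> {a..b} - S \<Longrightarrow> norm (g x) \<le> h x"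
    by (auto intro: AEI_negligible[OF le])
  have "integral {c..d} g = integral {c..d} (\<lambda>x. if x \<in> S then 0 else g x)"
    by (rule integral_spike[OF S(1)]) auto
  also have "norm \<dots> \<le> integral {c..d} (\<lambda>x. if x \<in> S then 0 else h x)"
    by (rule integral_norm_bound_integral)
      (use gi h S sub in \<open>auto intro: integrable_spike[OF _ S(1)]\<close>)
  also have "\<dots> = integral {c..d} h"
    by (rule integral_spike[OF S(1)]) auto
  finally show ?thesis .
qed

lemma W_integrable:
  assumes g: "W n g" and "x \<le> b"
  shows "g integrable_on {a..x}"
proof -
  have "g integrable_on {a..b}"
    by (rule bounded_measurable_integrable[OF W_imp_measurable[OF g] W_AE_bound[OF g]])
  then show ?thesis by (rule integrable_subinterval_real) (use assms in auto)
qed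

lemma norm_integral_W_le:
  assumes g: "W n g" and x: "a \<le> c" "c \<le> d" "d \<le> b"
  shows "norm (integral {c..d} g) \<le> (d - c) * Linf g"
proof -
  have "g integrable_on {c..d}"
    by (rule integrable_subinterval_real[OF W_integrable[OF g order_refl]]) (use x in auto)
  then have "norm (integral {c..d} g) \<le> integral {c..d} (\<lambda>_. Linf g)"
    by (rule norm_integral_le_AEI[OF _ Linf_AE[OF W_imp_ess_bounded[OF g]]]) (use x in auto)
  then show ?thesis using x by simp
qed

lemma continuous_bound:
  fixes u :: "real \<Rightarrow> 'e::real_normed_vector"
  assumes "continuous_on {a..b} u"
  obtains K where "K \<ge> 0" "\<And>x. x \<in> {a..b} \<Longrightarrow> norm (u x) \<le> K"
proof -
  have "bounded (u ` {a..b})"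
    by (rule compact_imp_bounded[OF compact_continuous_image[OF assms compact_Icc]])
  then obtain K where "K > 0" "\<forall>y\<in>u ` {a..b}. norm y \<le> K" unfolding bounded_pos by blast
  then show ?thesis using that[of K] by auto
qed

lemma continuous_imp_W0:
  assumes "continuous_on {a..b} u" shows "W 0 u"
proof -
  obtain K where "0 \<le> K" "\<And>x. x \<in> {a..b} \<Longrightarrow> norm (u x) \<le> K"
    by (rule continuous_bound[OF assms], rule that)
  then show ?thesis
    using assms by (auto simp: W_0 ess_bounded_def intro!: continuous_imp_measurable_on_sets_lebesgue exI[of _ K])
qed

lemma W_Suc_continuous: "W (Suc n) u \<Longrightarrow> continuous_on {a..b} u"
proof -
  assume u: "W (Suc n) u"
  have "continuous_on {a..b} (\<lambda>x. u a + integral {a..x} (wderiv u))"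
    by (intro continuous_intros indefinite_integral_continuous_1 W_integrable[OF W_Suc_D(2)[OF u]]) simp
  then show ?thesis
    by (rule continuous_on_eq) (rule W_Suc_D(3)[OF u, symmetric])
qed

text \<open>The equality that membership in \<open>W n\<close> respects: for \<open>n > 0\<close> an equality almost everywhere is not
  enough, because \<open>W_inf\<close> constrains the values at every point.\<close>

definition sob_eq :: "nat \<Rightarrow> (real \<Rightarrow> complex) \<Rightarrow> (real \<Rightarrow> complex) \<Rightarrow> bool" where
  "sob_eq n u v \<longleftrightarrow> AEI (\<lambda>x. u x = v x) \<and> (n > 0 \<longrightarrow> (\<forall>x\<in>{a..b}. u x = v x))"

lemma sob_eqI: "(\<And>x. x \<in> {a..b} \<Longrightarrow> u x = v x) \<Longrightarrow> sob_eq n u v"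
  by (auto simp: sob_eq_def)

lemma sob_eq_sym: "sob_eq n u v \<Longrightarrow> sob_eq n v u"
proof -
  have "AEI (\<lambda>x. u x = v x) \<Longrightarrow> AEI (\<lambda>x. v x = u x)" by (rule eventually_mono) auto
  then show "sob_eq n u v \<Longrightarrow> sob_eq n v u" by (auto simp: sob_eq_def)
qed

text \<open>A derivative within \<open>{a..b}\<close> sees only values there. Since the two
  differentiability predicates coincide, the choice made by \<open>vector_derivative\<close> is the
  same even where no derivative exists.\<close>

lemma sob_deriv_cong:
  "(\<And>x. x \<in> {a..b} \<Longrightarrow> u x = v x) \<Longrightarrow> x \<in> {a..b} \<Longrightarrow> sob_deriv a b j u x = sob_deriv a b j v x"
proof (induction j arbitrary: x)
  case (Suc j)
  have *: "sob_deriv a b j u y = sob_deriv a b j v y" if "y \<in> {a..b}" for y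
    using Suc that by blast
  have "(sob_deriv a b j u has_vector_derivative d) (at x within {a..b}) \<longleftrightarrow>
        (sob_deriv a b j v has_vector_derivative d) (at x within {a..b})" for d
    using has_vector_derivative_transform[OF Suc.prems(2), of "sob_deriv a b j u" "sob_deriv a b j v" d]
      has_vector_derivative_transform[OF Suc.prems(2), of "sob_deriv a b j v" "sob_deriv a b j u" d] *
    by metis
  then show ?case by (simp add: vector_derivative_def sob_deriv.simps(2))
qed simp

lemma W_N_cong:
  assumes eq: "sob_eq n u v" and u: "W n u"
  shows "W n v" and "N n v = N n u"
proof -
  have *: "AEI (\<lambda>x. sob_deriv a b j u x = sob_deriv a b j v x)" if "j \<le> n" for j
  proof (cases "n = 0")
    case True then show ?thesis using eq that by (simp add: sob_eq_def)
  next
    case False then show ?thesis using eq sob_deriv_cong[of u v _ j] by (auto simp: sob_eq_def)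
  qed
  have **: "sob_deriv a b j u x = sob_deriv a b j v x" if "j < n" "x \<in> {a..b}" for j x
    using eq that sob_deriv_cong[of u v _ j] by (auto simp: sob_eq_def)
  have int: "integral {a..x} (sob_deriv a b j u) = integral {a..x} (sob_deriv a b j v)" if j: "j \<le> n" and x: "x \<in> {a..b}" for j x
  proof -
    obtain S where "negligible S" "\<And>x. x \<in> {a..b} - S \<Longrightarrow> sob_deriv a b j u x = sob_deriv a b j v x"
      by (auto intro: AEI_negligible[OF *[OF j]])
    with x show ?thesis by (intro integral_spike) auto
  qed
  have u1: "sob_deriv a b j u \<in> borel_measurable (lebesgue_on {a..b})" "ess_bounded a b (sob_deriv a b j u)" if "j \<le> n" for j
    using u that unfolding W_inf_def by blast+
  have u2: "sob_deriv a b j u x = sob_deriv a b j u a + integral {a..x} (sob_deriv a b (Suc j) u)"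
    if "j < n" "x \<in> {a..b}" for j x
    using u that unfolding W_inf_def by blast
  show "W n v"
    unfolding W_inf_def
  proof (intro conjI allI impI ballI)
    fix j assume j: "j \<le> n"
    show "sob_deriv a b j v \<in> borel_measurable (lebesgue_on {a..b})"
      by (rule measurable_cong_AEI[OF u1(1)[OF j] *[OF j]])
    show "ess_bounded a b (sob_deriv a b j v)"
      by (rule ess_bounded_cong[OF *[OF j] u1(2)[OF j]])
  next
    fix j x assume j: "j < n" and x: "x \<in> {a..b}"
    show "sob_deriv a b j v x = sob_deriv a b j v a + integral {a..x} (sob_deriv a b (Suc j) v)"
      using u2[OF j x] **[OF j x] **[OF j, of a] int[OF _ x, of "Suc j"] j ab by simp
  qed
  show "N n v = N n u"
    unfolding W_norm_def by (rule sum.cong) (auto intro!: Linf_cong[symmetric] *)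
qed

lemma wderivI: "x \<in> {a..b} \<Longrightarrow> (u has_vector_derivative d) (at x within {a..b}) \<Longrightarrow> wderiv u x = d"
  unfolding wderiv_def by (rule vector_derivative_within_closed_interval) (use ab in auto)

lemma primitive_has_derivative_AE:
  fixes u :: "real \<Rightarrow> 'e::euclidean_space"
  assumes g: "g integrable_on {a..b}" and u: "\<And>x. x \<in> {a..b} \<Longrightarrow> u x = \<alpha> + integral {a..x} g"
  shows "AE x in lebesgue. x \<in> {a<..<b} \<longrightarrow> (u has_vector_derivative g x) (at x)"
  using indefinite_integral_derivative_AE[OF g]
proof eventually_elim
  case (elim x)
  show ?case
  proof
    assume x: "x \<in> {a<..<b}"
    then have "((\<lambda>x. \<alpha> + integral {a..x} g) has_vector_derivative 0 + g x) (at x)"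
      using elim by (intro has_vector_derivative_add has_vector_derivative_const) auto
    then show "(u has_vector_derivative g x) (at x)"
      by (intro has_vector_derivative_transform_within_open[of _ _ _ "{a<..<b}" u]) (use x u in auto)
  qed
qed

lemma wderiv_eq_AE:
  assumes "AE x in lebesgue. x \<in> {a<..<b} \<longrightarrow> (u has_vector_derivative g x) (at x)"
  shows "AEI (\<lambda>x. wderiv u x = g x)"
proof (rule AEI_open)
  show "AE x in lebesgue. x \<in> {a<..<b} \<longrightarrow> wderiv u x = g x"
    using assms by eventually_elim (auto intro!: wderivI has_vector_derivative_at_within)
qed

text \<open>The way to prove membership in \<open>W (Suc n)\<close>: exhibit a primitive. The two
  cases match the two clauses of \<open>sob_eq\<close>. For \<open>n = 0\<close> the derivative
  equals \<open>g\<close> only almost everywhere, by Lebesgue's theorem; for larger \<open>n\<close>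
  the function \<open>g\<close> is continuous and the equality holds at every point, with one-sided
  derivatives at the ends.\<close>

lemma W_primitive:
  assumes g: "W n g" and u: "\<And>x. x \<in> {a..b} \<Longrightarrow> u x = \<alpha> + integral {a..x} g"
  shows "W (Suc n) u" and "sob_eq n (wderiv u) g"
proof -
  have gi: "g integrable_on {a..b}" using W_integrable[OF g] by simp
  have ae: "AEI (\<lambda>x. wderiv u x = g x)"
    by (rule wderiv_eq_AE, rule primitive_has_derivative_AE[OF gi u])
  show eq: "sob_eq n (wderiv u) g"
  proof (cases n)
    case (Suc m)
    then have "continuous_on {a..b} g" using g W_Suc_continuous by blast
    have "wderiv u x = g x" if x: "x \<in> {a..b}" for x
    proof (rule wderivI[OF x])
      have "((\<lambda>x. \<alpha> + integral {a..x} g) has_vector_derivative 0 + g x) (at x within {a..b})"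
        by (intro has_vector_derivative_add has_vector_derivative_const integral_has_vector_derivative) fact+
      then show "(u has_vector_derivative g x) (at x within {a..b})"
        by (intro has_vector_derivative_transform[OF x u]) auto
    qed
    then show ?thesis by (rule sob_eqI)
  qed (use ae in \<open>simp add: sob_eq_def\<close>)
  have "continuous_on {a..b} (\<lambda>x. \<alpha> + integral {a..x} g)"
    by (intro continuous_intros indefinite_integral_continuous_1 gi)
  then have "continuous_on {a..b} u" by (rule continuous_on_eq) (use u in auto)
  then have "W 0 u" by (rule continuous_imp_W0)
  moreover have "W n (wderiv u)" by (rule W_N_cong(1)[OF sob_eq_sym[OF eq] g])
  moreover have "u x = u a + integral {a..x} (wderiv u)" if x: "x \<in> {a..b}" for x
  proof -
    obtain S where "negligible S" "\<And>x. x \<in> {a..b} - S \<Longrightarrow> wderiv u x = g x"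
      by (auto intro: AEI_negligible[OF ae])
    then have "integral {a..x} g = integral {a..x} (wderiv u)"
      using x by (intro integral_spike) auto
    then show ?thesis using u[of a] u[OF x] ab by simp
  qed
  ultimately show "W (Suc n) u" unfolding W_Suc by blast
qed

lemma N_primitive:
  assumes g: "W n g" and u: "\<And>x. x \<in> {a..b} \<Longrightarrow> u x = \<alpha> + integral {a..x} g"
  shows "N (Suc n) u = Linf u + N n g"
  using W_N_cong(2)[OF sob_eq_sym[OF W_primitive(2)[OF g u]] g] by (simp add: N_Suc)

section \<open>Linear operations, products and point evaluation\<close>

lemma W_0_add: "W 0 u \<Longrightarrow> W 0 v \<Longrightarrow> W 0 (\<lambda>x. u x + v x) \<and> N 0 (\<lambda>x. u x + v x) \<le> N 0 u + N 0 v"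
proof -
  assume u: "W 0 u" and v: "W 0 v"
  have "AEI (\<lambda>x. norm (u x + v x) \<le> N 0 u + N 0 v)"
    using W_AE_bound[OF u] W_AE_bound[OF v] by eventually_elim (auto intro: norm_triangle_le)
  then show ?thesis
    using u v by (auto simp: W_0 ess_bounded_def N_0 intro!: Linf_le)
qed

text \<open>\<open>wderiv\<close> is not additive at points where a derivative fails to exist. The
  sum is therefore shown to be the primitive of the sum of the derivatives, and
  \<open>W_primitive\<close> does the rest; the other operations follow the same pattern.\<close>

lemma W_N_add:
  "W n u \<Longrightarrow> W n v \<Longrightarrow> W n (\<lambda>x. u x + v x) \<and> N n (\<lambda>x. u x + v x) \<le> N n u + N n v"
proof (induction n arbitrary: u v)
  case 0 then show ?case by (rule W_0_add)
next
  case (Suc n)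
  have IH: "W n (\<lambda>x. wderiv u x + wderiv v x)" "N n (\<lambda>x. wderiv u x + wderiv v x) \<le> N n (wderiv u) + N n (wderiv v)"
    using Suc.IH[OF W_Suc_D(2)[OF Suc.prems(1)] W_Suc_D(2)[OF Suc.prems(2)]] by auto
  have eq: "u x + v x = (u a + v a) + integral {a..x} (\<lambda>x. wderiv u x + wderiv v x)" if "x \<in> {a..b}" for x
  proof -
    have "(\<lambda>x. wderiv u x) integrable_on {a..x}" "(\<lambda>x. wderiv v x) integrable_on {a..x}"
      using that by (auto intro: W_integrable W_Suc_D(2) Suc.prems)
    then show ?thesis
      using W_Suc_D(3)[OF Suc.prems(1) that] W_Suc_D(3)[OF Suc.prems(2) that]
      by (simp add: integral_add)
  qed
  show ?case
    using W_primitive(1)[OF IH(1) eq] N_primitive[OF IH(1) eq] IH(2)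
      W_0_add[OF W_Suc_D(1)[OF Suc.prems(1)] W_Suc_D(1)[OF Suc.prems(2)]]
    by (auto simp: N_Suc N_0)
qed

lemma W_0_cmul: "W 0 u \<Longrightarrow> W 0 (\<lambda>x. s * u x) \<and> N 0 (\<lambda>x. s * u x) \<le> norm s * N 0 u"
proof -
  assume u: "W 0 u"
  have "AEI (\<lambda>x. norm (s * u x) \<le> norm s * N 0 u)"
    using W_AE_bound[OF u] by eventually_elim (auto simp: norm_mult mult_left_mono)
  then show ?thesis
    using u by (auto simp: W_0 ess_bounded_def N_0 intro!: Linf_le)
qed

lemma W_N_cmul: "W n u \<Longrightarrow> W n (\<lambda>x. s * u x) \<and> N n (\<lambda>x. s * u x) \<le> norm s * N n u"
proof (induction n arbitrary: u)
  case 0 then show ?case by (rule W_0_cmul)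
next
  case (Suc n)
  have IH: "W n (\<lambda>x. s * wderiv u x)" "N n (\<lambda>x. s * wderiv u x) \<le> norm s * N n (wderiv u)"
    using Suc.IH[OF W_Suc_D(2)[OF Suc.prems]] by auto
  have eq: "s * u x = s * u a + integral {a..x} (\<lambda>x. s * wderiv u x)" if "x \<in> {a..b}" for x
    using W_Suc_D(3)[OF Suc.prems that] by (simp add: distrib_left)
  show ?case
    using W_primitive(1)[OF IH(1) eq] N_primitive[OF IH(1) eq] IH(2)
      W_0_cmul[OF W_Suc_D(1)[OF Suc.prems], of s]
    by (auto simp: N_Suc N_0 distrib_left)
qed

lemma W_N_const: "W n (\<lambda>_. c) \<and> N n (\<lambda>_. c) \<le> norm c"
proof (induction n arbitrary: c)
  case 0 then show ?case by (auto simp: W_0 N_0 ess_bounded_def intro: Linf_le)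
next
  case (Suc n)
  have eq: "c = c + integral {a..x} (\<lambda>_. 0)" for x by simp
  have "Linf (\<lambda>_. c) \<le> norm c" by (auto intro: Linf_le)
  then show ?case
    using Suc[of 0] W_primitive(1)[of n "\<lambda>_. 0" "\<lambda>_. c", OF _ eq] N_primitive[of n "\<lambda>_. 0" "\<lambda>_. c", OF _ eq] by auto
qed

lemma W_N_diff:
  assumes "W n u" "W n v" shows "W n (\<lambda>x. u x - v x) \<and> N n (\<lambda>x. u x - v x) \<le> N n u + N n v"
  using W_N_add[of n u "\<lambda>x. -1 * v x"] W_N_cmul[of n v "-1"] assms by auto

lemma W_N_sum:
  "finite J \<Longrightarrow> (\<And>i. i \<in> J \<Longrightarrow> W n (u i)) \<Longrightarrow>
   W n (\<lambda>x. \<Sum>i\<in>J. u i x) \<and> N n (\<lambda>x. \<Sum>i\<in>J. u i x) \<le> (\<Sum>i\<in>J. N n (u i))"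
proof (induction J rule: finite_induct)
  case (insert i J)
  then show ?case using W_N_add[of n "u i" "\<lambda>x. \<Sum>i\<in>J. u i x"] by fastforce
qed (use W_N_const[of n 0] in simp)

lemma W_0_mult: "W 0 u \<Longrightarrow> W 0 v \<Longrightarrow> W 0 (\<lambda>x. u x * v x) \<and> N 0 (\<lambda>x. u x * v x) \<le> N 0 u * N 0 v"
proof -
  assume u: "W 0 u" and v: "W 0 v"
  have "AEI (\<lambda>x. norm (u x * v x) \<le> N 0 u * N 0 v)"
    using W_AE_bound[OF u] W_AE_bound[OF v] N_nonneg[OF u]
    by eventually_elim (auto simp: norm_mult intro!: mult_mono')
  then show ?thesis
    using u v by (auto simp: W_0 ess_bounded_def N_0 intro!: Linf_le)
qed

lemma W_Suc_lipschitz: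
  assumes u: "W (Suc n) u" shows "(Linf (wderiv u))-lipschitz_on {a..b} u"
proof (rule lipschitz_onI)
  have g: "W n (wderiv u)" using u by (rule W_Suc_D(2))
  show "0 \<le> Linf (wderiv u)" by (rule Linf_nonneg[OF W_imp_ess_bounded[OF g]])
  have *: "norm (u y - u x) \<le> Linf (wderiv u) * (y - x)" if "x \<in> {a..b}" "y \<in> {a..b}" "x \<le> y" for x y
  proof -
    have "integral {a..x} (wderiv u) + integral {x..y} (wderiv u) = integral {a..y} (wderiv u)"
      by (rule Henstock_Kurzweil_Integration.integral_combine) (use that W_integrable[OF g] in auto)
    moreover have "u x = u a + integral {a..x} (wderiv u)" "u y = u a + integral {a..y} (wderiv u)"
      by (rule W_Suc_D(3)[OF u that(1)], rule W_Suc_D(3)[OF u that(2)])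
    ultimately have "u y - u x = integral {x..y} (wderiv u)" by (metis add_diff_cancel_left' add_diff_cancel_left)
    then show ?thesis using norm_integral_W_le[OF g, of x y] that by (simp add: mult.commute)
  qed
  fix x y assume "x \<in> {a..b}" "y \<in> {a..b}"
  then show "dist (u x) (u y) \<le> Linf (wderiv u) * dist x y"
    using *[of x y] *[of y x] by (cases "x \<le> y") (auto simp: dist_norm norm_minus_commute)
qed

lemma W_Suc_derivative_AE:
  assumes u: "W (Suc n) u"
  shows "AE x in lebesgue. x \<in> {a<..<b} \<longrightarrow> (u has_vector_derivative wderiv u x) (at x)"
  by (rule primitive_has_derivative_AE[OF W_integrable[OF W_Suc_D(2)[OF u] order_refl] W_Suc_D(3)[OF u]])

text \<open>Integration by parts: the product of two bounded Lipschitz functions is Lipschitz, and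
  the product rule holds almost everywhere, so the fundamental theorem for Lipschitz functions
  applies on \<open>{a..x}\<close>.\<close>

lemma W_mult_primitive:
  assumes u: "W (Suc n) u" and v: "W (Suc n) v" and x: "x \<in> {a..b}"
  shows "u x * v x = u a * v a + integral {a..x} (\<lambda>x. wderiv u x * v x + u x * wderiv v x)"
proof -
  obtain K where K: "K \<ge> 0" "\<And>x. x \<in> {a..b} \<Longrightarrow> norm (u x) \<le> K"
    by (rule continuous_bound[OF W_Suc_continuous[OF u]], rule that)
  obtain L where L: "L \<ge> 0" "\<And>x. x \<in> {a..b} \<Longrightarrow> norm (v x) \<le> L"
    by (rule continuous_bound[OF W_Suc_continuous[OF v]], rule that)
  note Lu = W_Suc_lipschitz[OF u] and Lv = W_Suc_lipschitz[OF v]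
  have lip: "(Linf (wderiv u) * L + K * Linf (wderiv v))-lipschitz_on {a..x} (\<lambda>x. u x * v x)"
  proof (rule lipschitz_onI)
    show "0 \<le> Linf (wderiv u) * L + K * Linf (wderiv v)"
      using K(1) L(1) lipschitz_on_nonneg[OF Lu] lipschitz_on_nonneg[OF Lv] by simp
    fix s t assume "s \<in> {a..x}" "t \<in> {a..x}"
    then have st: "s \<in> {a..b}" "t \<in> {a..b}" using x by auto
    have "u s * v s - u t * v t = (u s - u t) * v s + u t * (v s - v t)" by (simp add: algebra_simps)
    also have "norm \<dots> \<le> norm (u s - u t) * norm (v s) + norm (u t) * norm (v s - v t)"
      by (metis norm_mult norm_triangle_ineq)
    also have "\<dots> \<le> (Linf (wderiv u) * \<bar>s - t\<bar>) * L + K * (Linf (wderiv v) * \<bar>s - t\<bar>)"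
      using lipschitz_on_normD[OF Lu st] lipschitz_on_normD[OF Lv st] K L st
        lipschitz_on_nonneg[OF Lu]
      by (intro add_mono mult_mono) auto
    finally show "dist (u s * v s) (u t * v t) \<le> (Linf (wderiv u) * L + K * Linf (wderiv v)) * dist s t"
      by (simp add: dist_norm algebra_simps)
  qed
  have "AE t in lebesgue. t \<in> {a<..<x} \<longrightarrow>
     ((\<lambda>x. u x * v x) has_vector_derivative (wderiv u t * v t + u t * wderiv v t)) (at t)"
    using W_Suc_derivative_AE[OF u] W_Suc_derivative_AE[OF v]
    by eventually_elim (use x in \<open>auto intro!: derivative_eq_intros simp: algebra_simps\<close>)
  from lipschitz_has_integral_derivative_AE[OF _ lip this] x show ?thesis
    by (auto simp: integral_unique)
qed

text \<open>Differentiating a product gives two products, which costs one factor 2 per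
  order.\<close>

lemma W_N_mult:
  "W n u \<Longrightarrow> W n v \<Longrightarrow> W n (\<lambda>x. u x * v x) \<and> N n (\<lambda>x. u x * v x) \<le> 2 ^ n * N n u * N n v"
proof (induction n arbitrary: u v)
  case 0 then show ?case using W_0_mult by simp
next
  case (Suc n)
  have W: "W n u" "W n v" "W n (wderiv u)" "W n (wderiv v)" "W 0 u" "W 0 v"
    using Suc.prems W_mono[of n "Suc n"] W_Suc_D by auto
  let ?g = "\<lambda>x. wderiv u x * v x + u x * wderiv v x"
  note IH = Suc.IH[OF W(3,2)] Suc.IH[OF W(1,4)]
  have "W n ?g" and le_g: "N n ?g \<le> N n (\<lambda>x. wderiv u x * v x) + N n (\<lambda>x. u x * wderiv v x)"
    using W_N_add[OF IH(1)[THEN conjunct1] IH(2)[THEN conjunct1]] by blast+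
  note g = \<open>W n ?g\<close>
  note eq = W_mult_primitive[OF Suc.prems]
  define U V where "U = Linf u" and "V = Linf v"
  define U' V' where "U' = N n (wderiv u)" and "V' = N n (wderiv v)"
  have nn: "U \<ge> 0" "V \<ge> 0" "U' \<ge> 0" "V' \<ge> 0"
    using W by (auto simp: U_def V_def U'_def V'_def N_nonneg Linf_nonneg W_imp_ess_bounded)
  have le: "N n u \<le> U + U'" "N n v \<le> V + V'"
    using N_mono[of n "Suc n"] Suc.prems by (auto simp: N_Suc U_def U'_def V_def V'_def)
  have "2 ^ n * N n (wderiv u) * N n v \<le> 2 ^ n * U' * (V + V')"
    unfolding U'_def[symmetric] by (rule mult_left_mono[OF le(2)]) (use nn in simp)
  moreover have "2 ^ n * N n u * N n (wderiv v) \<le> 2 ^ n * (U + U') * V'"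
    unfolding V'_def[symmetric] by (intro mult_right_mono mult_left_mono le) (use nn in simp_all)
  ultimately have "N n ?g \<le> 2 ^ n * U' * (V + V') + 2 ^ n * (U + U') * V'"
    using le_g IH(1)[THEN conjunct2] IH(2)[THEN conjunct2] by linarith
  moreover have "Linf (\<lambda>x. u x * v x) \<le> 2 ^ n * (U * V)"
  proof -
    have "Linf (\<lambda>x. u x * v x) \<le> 1 * (U * V)"
      using W_0_mult[OF W(5,6)] by (simp add: N_0 U_def V_def)
    also have "\<dots> \<le> 2 ^ n * (U * V)" by (rule mult_right_mono) (use nn in simp_all)
    finally show ?thesis .
  qed
  ultimately have "N (Suc n) (\<lambda>x. u x * v x) \<le> 2 ^ n * (U * V + U' * (V + V') + (U + U') * V')"
    using N_primitive[OF g eq] by (simp add: algebra_simps)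
  also have "\<dots> \<le> 2 ^ n * (2 * ((U + U') * (V + V')))"
  proof (rule mult_left_mono)
    have "0 \<le> U * V + U * V' + U' * V" using nn by simp
    then show "U * V + U' * (V + V') + (U + U') * V' \<le> 2 * ((U + U') * (V + V'))"
      using nn by (simp add: algebra_simps)
  qed simp
  finally have "N (Suc n) (\<lambda>x. u x * v x) \<le> 2 ^ Suc n * N (Suc n) u * N (Suc n) v"
    by (simp add: N_Suc U_def V_def U'_def V'_def)
  with W_primitive(1)[OF g eq] show ?case by simp
qed

text \<open>\<open>u x\<close> is compared with \<open>u y\<close> for almost every \<open>y\<close>
  by the Lipschitz bound; the resulting estimate does not mention \<open>y\<close>, so
  \<open>AEI_const\<close> makes it unconditional.\<close>

lemma W_Suc_pointwise:
  assumes u: "W (Suc n) u" and x: "x \<in> {a..b}"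
  shows "norm (u x) \<le> (1 + (b - a)) * N (Suc n) u"
proof -
  note D = W_Suc_D[OF u]
  define d where "d = Linf (wderiv u)"
  have d: "0 \<le> d" unfolding d_def by (rule Linf_nonneg[OF W_imp_ess_bounded[OF D(2)]])
  have U: "0 \<le> Linf u" by (rule Linf_nonneg[OF W_imp_ess_bounded[OF u]])
  have "AEI (\<lambda>y. norm (u x) \<le> Linf u + (b - a) * d)"
    using Linf_AE[OF W_imp_ess_bounded[OF u]]
  proof eventually_elim
    case (elim y)
    show ?case
    proof
      assume y: "y \<in> {a..b}"
      have "norm (u x) \<le> norm (u y) + norm (u x - u y)" by (metis add.commute norm_triangle_sub)
      also have "norm (u x - u y) \<le> d * \<bar>x - y\<bar>"
        using lipschitz_on_normD[OF W_Suc_lipschitz[OF u] x y] by (simp add: d_def)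
      also have "d * \<bar>x - y\<bar> \<le> d * (b - a)"
        using x y d by (intro mult_left_mono) auto
      finally show "norm (u x) \<le> Linf u + (b - a) * d" using elim y by (simp add: mult.commute)
    qed
  qed
  then have "norm (u x) \<le> Linf u + (b - a) * d" by (simp only: AEI_const)
  also have "\<dots> \<le> (1 + (b - a)) * (Linf u + d)"
  proof -
    have "0 \<le> (b - a) * Linf u" using ab U by simp
    moreover have "(1 + (b - a)) * (Linf u + d) = Linf u + (b - a) * d + (d + (b - a) * Linf u)"
      by (simp add: algebra_simps)
    ultimately show ?thesis using d by linarith
  qed
  also have "Linf u + d \<le> N (Suc n) u"
    using Linf_le_N[OF D(2)] by (simp add: N_Suc d_def)
  finally show ?thesis using ab by (simp add: mult_left_mono)
qed

section \<open>Completeness through absolutely summable series\<close>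

lemma W_0_complete:
  assumes h: "\<And>k. W 0 (h k)" and s: "summable (\<lambda>k. N 0 (h k))"
  shows "\<exists>u. W 0 u \<and> (\<forall>k. N 0 (\<lambda>x. u x - (\<Sum>i<k. h i x)) \<le> (\<Sum>i. N 0 (h (i + k))))"
proof -
  \<comment> \<open>Cutting each term off where it exceeds its essential bound makes the series
    converge absolutely at every point, without changing any term outside a null set.\<close>
  define g where "g = (\<lambda>i x. if norm (h i x) \<le> N 0 (h i) then h i x else 0)"
  define u where "u = (\<lambda>x. \<Sum>i. g i x)"
  have eq: "AE x in lebesgue. \<forall>i. x \<in> {a..b} \<longrightarrow> h i x = g i x"
  proof (subst AE_all_countable, intro allI)
    fix i show "AEI (\<lambda>x. h i x = g i x)"
      using W_AE_bound[OF h[of i]] by eventually_elim (simp add: g_def)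
  qed
  have g_le: "norm (g i x) \<le> N 0 (h i)" for i x
    using N_nonneg[OF h] by (simp add: g_def)
  have gs: "summable (\<lambda>i. norm (g (i + k) x))" for k x
    by (rule summable_comparison_test[OF _ summable_ignore_initial_segment[OF s, of k]]) (use g_le in auto)
  have tail: "AEI (\<lambda>x. norm (u x - (\<Sum>i<k. h i x)) \<le> (\<Sum>i. N 0 (h (i + k))))" for k
    using eq
  proof eventually_elim
    case (elim x)
    show ?case
    proof
      assume x: "x \<in> {a..b}"
      have "u x - (\<Sum>i<k. h i x) = (\<Sum>i. g (i + k) x)"
        using suminf_minus_initial_segment[OF summable_norm_cancel[OF gs[of 0 x, simplified]], of k] elim x
        by (simp add: u_def)
      also have "norm \<dots> \<le> (\<Sum>i. norm (g (i + k) x))" by (rule summable_norm[OF gs])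
      also have "\<dots> \<le> (\<Sum>i. N 0 (h (i + k)))"
        by (rule suminf_le[OF g_le gs summable_ignore_initial_segment[OF s]])
      finally show "norm (u x - (\<Sum>i<k. h i x)) \<le> (\<Sum>i. N 0 (h (i + k)))" .
    qed
  qed
  have "g i \<in> borel_measurable (lebesgue_on {a..b})" for i
  proof (rule measurable_cong_AEI[OF W_imp_measurable[OF h]])
    show "AEI (\<lambda>x. h i x = g i x)" using eq by eventually_elim auto
  qed
  then have "u \<in> borel_measurable (lebesgue_on {a..b})"
    unfolding u_def by (rule borel_measurable_suminf)
  moreover have "ess_bounded a b u" using tail[of 0] unfolding ess_bounded_def by auto
  ultimately have "W 0 u" by (simp add: W_0)
  with tail show ?thesis by (auto simp: N_0 intro!: exI[of _ u] Linf_le)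
qed

text \<open>The limit is the primitive of the limit of the derivatives, started at the sum of the
  values at \<open>a\<close>. With \<open>d = b - a\<close> and \<open>C\<close> the constant of
  order \<open>n\<close>, the initial values contribute \<open>1 + d\<close>, the integral
  \<open>d * C\<close> and the derivative \<open>C\<close>; the total
  \<open>(1 + d) * (1 + C)\<close> is at most \<open>2 * (1 + d) * C\<close> since
  \<open>C \<ge> 1\<close>. The explicit tail bound is what the gliding hump requires.\<close>

lemma W_complete:
  "(\<And>k. W n (h k)) \<Longrightarrow> summable (\<lambda>k. N n (h k)) \<Longrightarrow>
   \<exists>u. W n u \<and> (\<forall>k. N n (\<lambda>x. u x - (\<Sum>i<k. h i x)) \<le> (2 * (1 + (b - a))) ^ n * (\<Sum>i. N n (h (i + k))))"
proof (induction n arbitrary: h)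
  case 0 then show ?case using W_0_complete[of h] by simp
next
  case (Suc n)
  define d where "d = b - a"
  have d: "d > 0" using ab by (simp add: d_def)
  define C where "C = (2 * (1 + d)) ^ n"
  have C: "C \<ge> 1" unfolding C_def using d by (intro one_le_power) simp
  note h = W_Suc_D[OF Suc.prems(1)]
  note s = Suc.prems(2)
  have "norm (N n (wderiv (h k))) \<le> N (Suc n) (h k)" for k
    using N_nonneg[OF h(2)] Linf_nonneg[OF W_imp_ess_bounded[OF h(1)]] by (simp add: N_Suc)
  then have s': "summable (\<lambda>k. N n (wderiv (h k)))"
    by (intro summable_comparison_test[OF _ s]) auto
  from Suc.IH[OF h(2) s'] obtain g where g: "W n g"
    "\<And>k. N n (\<lambda>x. g x - (\<Sum>i<k. wderiv (h i) x)) \<le> C * (\<Sum>i. N n (wderiv (h (i + k))))"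
    by (auto simp: C_def d_def)
  have ha: "norm (h i a) \<le> (1 + d) * N (Suc n) (h i)" for i
    using W_Suc_pointwise[OF Suc.prems(1), of a i] ab by (simp add: d_def)
  have sa: "summable (\<lambda>i. norm (h (i + k) a))" for k
    by (rule summable_comparison_test[OF _ summable_mult[OF summable_ignore_initial_segment[OF s, of k], of "1 + d"]])
      (use ha in auto)
  define u where "u = (\<lambda>x. (\<Sum>i. h i a) + integral {a..x} g)"
  have "W (Suc n) u" by (rule W_primitive(1)[OF g(1)]) (simp add: u_def)
  moreover have "N (Suc n) (\<lambda>x. u x - (\<Sum>i<k. h i x)) \<le> (2 * (1 + d)) ^ Suc n * (\<Sum>i. N (Suc n) (h (i + k)))" for k
  proof -
    define \<tau> where "\<tau> = (\<Sum>i. N (Suc n) (h (i + k)))"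
    have "\<tau> \<ge> 0" unfolding \<tau>_def
      by (rule suminf_nonneg[OF summable_ignore_initial_segment[OF s]]) (rule N_nonneg[OF Suc.prems(1)])
    let ?r = "\<lambda>x. g x - (\<Sum>i<k. wderiv (h i) x)"
    let ?S = "\<lambda>x. \<Sum>i<k. wderiv (h i) x"
    have WS: "W n ?S" using W_N_sum[of "{..<k}" n "\<lambda>i. wderiv (h i)"] h(2) by auto
    have r: "W n ?r" using W_N_diff[OF g(1) WS] by blast
    have "(\<Sum>i. N n (wderiv (h (i + k)))) \<le> \<tau>"
      unfolding \<tau>_def
    proof (rule suminf_le)
      show "N n (wderiv (h (i + k))) \<le> N (Suc n) (h (i + k))" for i
        using Linf_nonneg[OF W_imp_ess_bounded[OF h(1)]] by (simp add: N_Suc)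
    qed (rule summable_ignore_initial_segment[OF s'] summable_ignore_initial_segment[OF s])+
    then have rN: "N n ?r \<le> C * \<tau>"
      using g(2)[of k] C by (meson mult_left_mono order_trans zero_le_one)
    define \<rho> where "\<rho> = (\<Sum>i. h i a) - (\<Sum>i<k. h i a)"
    have eq: "u x - (\<Sum>i<k. h i x) = \<rho> + integral {a..x} ?r" if x: "x \<in> {a..b}" for x
    proof -
      have "integral {a..x} ?r = integral {a..x} g - (\<Sum>i<k. integral {a..x} (wderiv (h i)))"
        using W_integrable[OF g(1)] W_integrable[OF WS] W_integrable[OF h(2)] x
        by (simp add: integral_diff integral_sum)
      moreover have "(\<Sum>i<k. h i x) = (\<Sum>i<k. h i a) + (\<Sum>i<k. integral {a..x} (wderiv (h i)))"
        unfolding sum.distrib[symmetric] by (rule sum.cong) (simp_all add: h(3)[OF x, symmetric])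
      ultimately show ?thesis by (simp add: u_def \<rho>_def)
    qed
    have "\<rho> = (\<Sum>i. h (i + k) a)"
      unfolding \<rho>_def using suminf_minus_initial_segment[OF summable_norm_cancel[OF sa[of 0, simplified]], of k] by simp
    then have "norm \<rho> \<le> (\<Sum>i. norm (h (i + k) a))" using summable_norm[OF sa] by simp
    also have "\<dots> \<le> (\<Sum>i. (1 + d) * N (Suc n) (h (i + k)))"
      by (rule suminf_le[OF ha sa summable_mult[OF summable_ignore_initial_segment[OF s]]])
    also have "\<dots> = (1 + d) * \<tau>"
      unfolding \<tau>_def by (rule suminf_mult[OF summable_ignore_initial_segment[OF s]])
    finally have \<rho>: "norm \<rho> \<le> (1 + d) * \<tau>" .
    have "Linf (\<lambda>x. u x - (\<Sum>i<k. h i x)) \<le> (1 + d) * \<tau> + d * (C * \<tau>)"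
    proof (rule Linf_le, rule AE_I2, rule impI)
      fix x assume x: "x \<in> {a..b}"
      have "norm (integral {a..x} ?r) \<le> (x - a) * Linf ?r"
        by (rule norm_integral_W_le[OF r]) (use x in auto)
      also have "\<dots> \<le> d * (C * \<tau>)"
        using x Linf_le_N[OF r] rN Linf_nonneg[OF W_imp_ess_bounded[OF r]] d
        by (intro mult_mono) (auto simp: d_def)
      finally have "norm (integral {a..x} ?r) \<le> d * (C * \<tau>)" .
      then show "norm (u x - (\<Sum>i<k. h i x)) \<le> (1 + d) * \<tau> + d * (C * \<tau>)"
        unfolding eq[OF x] using \<rho> norm_triangle_ineq[of \<rho> "integral {a..x} ?r"] by linarith
    qed
    moreover have "N (Suc n) (\<lambda>x. u x - (\<Sum>i<k. h i x)) = Linf (\<lambda>x. u x - (\<Sum>i<k. h i x)) + N n ?r"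
      by (rule N_primitive[OF r eq])
    ultimately have "N (Suc n) (\<lambda>x. u x - (\<Sum>i<k. h i x)) \<le> (1 + d) * \<tau> + d * (C * \<tau>) + C * \<tau>"
      using rN by linarith
    also have "\<dots> = (1 + d) * (1 + C) * \<tau>" by (simp add: algebra_simps)
    also have "\<dots> \<le> (1 + d) * (2 * C) * \<tau>"
      using C d \<open>\<tau> \<ge> 0\<close> by (intro mult_right_mono mult_left_mono) auto
    also have "\<dots> = (2 * (1 + d)) ^ Suc n * \<tau>" by (simp add: C_def)
    finally show ?thesis by (simp add: \<tau>_def)
  qed
  ultimately show ?case unfolding d_def by blast
qed

section \<open>Vector-valued and matrix-valued functions\<close>

abbreviation vW :: "nat \<Rightarrow> (real \<Rightarrow> complex ^ 'm::finite) \<Rightarrow> bool" where "vW \<equiv> vW_inf a b"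
abbreviation vN :: "nat \<Rightarrow> (real \<Rightarrow> complex ^ 'm::finite) \<Rightarrow> real" where "vN \<equiv> vW_norm a b"
abbreviation mW :: "nat \<Rightarrow> (real \<Rightarrow> complex ^ 'm ^ 'm::finite) \<Rightarrow> bool" where "mW \<equiv> mW_inf a b"
abbreviation mN :: "nat \<Rightarrow> (real \<Rightarrow> complex ^ 'm ^ 'm::finite) \<Rightarrow> real" where "mN \<equiv> mW_norm a b"

lemma vW_D: "vW n y \<Longrightarrow> W n (\<lambda>x. y x $ i)"
  by (simp add: vW_inf_def)

lemma mW_D: "mW n A \<Longrightarrow> W n (\<lambda>x. A x $ i $ j)"
  by (simp add: mW_inf_def)

lemma vW_mono: "m \<le> n \<Longrightarrow> vW n y \<Longrightarrow> vW m y"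
  unfolding vW_inf_def using W_mono by blast

lemma mW_mono: "m \<le> n \<Longrightarrow> mW n A \<Longrightarrow> mW m A"
  unfolding mW_inf_def using W_mono by blast

lemma vN_mono: "m \<le> n \<Longrightarrow> vW n y \<Longrightarrow> vN m y \<le> vN n y"
  unfolding vW_norm_def by (rule sum_mono) (rule N_mono[OF _ vW_D])

lemma mN_mono: "m \<le> n \<Longrightarrow> mW n A \<Longrightarrow> mN m A \<le> mN n A"
  unfolding mW_norm_def by (intro sum_mono) (rule N_mono[OF _ mW_D])

lemma vN_nonneg: "vW n y \<Longrightarrow> 0 \<le> vN n y"
  unfolding vW_norm_def by (rule sum_nonneg) (rule N_nonneg[OF vW_D])

lemma mN_nonneg: "mW n A \<Longrightarrow> 0 \<le> mN n A"
  unfolding mW_norm_def by (intro sum_nonneg) (rule N_nonneg[OF mW_D])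

lemma vW_N_add:
  assumes "vW n y" "vW n z"
  shows "vW n (\<lambda>x. y x + z x)" "vN n (\<lambda>x. y x + z x) \<le> vN n y + vN n z"
  using W_N_add[OF vW_D[OF assms(1)] vW_D[OF assms(2)]]
  by (auto simp: vW_inf_def vW_norm_def sum.distrib[symmetric] intro!: sum_mono)

lemma vW_N_diff:
  assumes "vW n y" "vW n z"
  shows "vW n (\<lambda>x. y x - z x)" "vN n (\<lambda>x. y x - z x) \<le> vN n y + vN n z"
  using W_N_diff[OF vW_D[OF assms(1)] vW_D[OF assms(2)]]
  by (auto simp: vW_inf_def vW_norm_def sum.distrib[symmetric] intro!: sum_mono)

lemma vW_N_cmul:
  assumes "vW n y"
  shows "vW n (\<lambda>x. s *s y x)" "vN n (\<lambda>x. s *s y x) \<le> norm s * vN n y"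
  using W_N_cmul[OF vW_D[OF assms], of s]
  by (auto simp: vW_inf_def vW_norm_def sum_distrib_left intro!: sum_mono)

lemma vW_const: "vW n (\<lambda>_. c)" and vN_zero: "vN n (\<lambda>_. 0) = 0"
proof -
  show "vW n (\<lambda>_. c)" using W_N_const by (auto simp: vW_inf_def)
  have "N n (\<lambda>_. 0) = 0" using W_N_const[of n 0] N_nonneg[of n "\<lambda>_. 0"] by auto
  then show "vN n (\<lambda>_. 0) = 0" by (simp add: vW_norm_def)
qed

lemma vW_N_matvec:
  assumes "mW n A" "vW n y"
  shows "vW n (\<lambda>x. A x *v y x)" "vN n (\<lambda>x. A x *v y x) \<le> 2 ^ n * mN n A * vN n y"
proof -
  have m: "W n (\<lambda>x. A x $ i $ j * y x $ j)" "N n (\<lambda>x. A x $ i $ j * y x $ j) \<le> 2 ^ n * N n (\<lambda>x. A x $ i $ j) * N n (\<lambda>x. y x $ j)" for i j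
    using W_N_mult[OF mW_D[OF assms(1)] vW_D[OF assms(2)]] by auto
  have s: "W n (\<lambda>x. \<Sum>j\<in>UNIV. A x $ i $ j * y x $ j)"
     "N n (\<lambda>x. \<Sum>j\<in>UNIV. A x $ i $ j * y x $ j) \<le> (\<Sum>j\<in>UNIV. N n (\<lambda>x. A x $ i $ j * y x $ j))" for i
    using W_N_sum[of UNIV n "\<lambda>j x. A x $ i $ j * y x $ j"] m by auto
  show "vW n (\<lambda>x. A x *v y x)" using s by (simp add: vW_inf_def matrix_vector_mult_def)
  have le: "N n (\<lambda>x. y x $ j) \<le> vN n y" for j
    unfolding vW_norm_def by (rule member_le_sum) (auto intro: N_nonneg vW_D assms)
  have "vN n (\<lambda>x. A x *v y x) \<le> (\<Sum>i\<in>UNIV. \<Sum>j\<in>UNIV. 2 ^ n * N n (\<lambda>x. A x $ i $ j) * vN n y)"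
    unfolding vW_norm_def matrix_vector_mult_def vec_lambda_beta
  proof (rule sum_mono)
    fix i :: 'a
    have "N n (\<lambda>x. \<Sum>j\<in>UNIV. A x $ i $ j * y x $ j) \<le> (\<Sum>j\<in>UNIV. N n (\<lambda>x. A x $ i $ j * y x $ j))" by (rule s)
    also have "\<dots> \<le> (\<Sum>j\<in>UNIV. 2 ^ n * N n (\<lambda>x. A x $ i $ j) * vN n y)"
      by (intro sum_mono order_trans[OF m(2)] mult_left_mono le) (simp add: N_nonneg[OF mW_D[OF assms(1)]])
    finally show "N n (\<lambda>x. \<Sum>j\<in>UNIV. A x $ i $ j * y x $ j)
      \<le> (\<Sum>j\<in>UNIV. 2 ^ n * N n (\<lambda>x. A x $ i $ j) * (\<Sum>i\<in>UNIV. N n (\<lambda>x. y x $ i)))"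
      by (simp add: vW_norm_def)
  qed
  also have "\<dots> = 2 ^ n * mN n A * vN n y"
    by (simp add: mW_norm_def sum_distrib_left sum_distrib_right)
  finally show "vN n (\<lambda>x. A x *v y x) \<le> 2 ^ n * mN n A * vN n y" .
qed

lemma vW_complete:
  fixes h :: "nat \<Rightarrow> real \<Rightarrow> complex ^ 'm"
  assumes h: "\<And>k. vW n (h k)" and s: "summable (\<lambda>k. vN n (h k))"
  shows "\<exists>u. vW n u \<and> (\<forall>k. vN n (\<lambda>x. u x - (\<Sum>i<k. h i x)) \<le> (2 * (1 + (b - a))) ^ n * (\<Sum>i. vN n (h (i + k))))"
proof -
  have sj: "summable (\<lambda>k. N n (\<lambda>x. h k x $ j))" for j
  proof (rule summable_comparison_test[OF _ s])
    have "N n (\<lambda>x. h k x $ j) \<le> vN n (h k)" for k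
      unfolding vW_norm_def by (rule member_le_sum) (auto intro: N_nonneg vW_D h)
    then show "\<exists>K. \<forall>k\<ge>K. norm (N n (\<lambda>x. h k x $ j)) \<le> vN n (h k)"
      using N_nonneg[OF vW_D[OF h]] by auto
  qed
  have "\<forall>j. \<exists>u. W n u \<and> (\<forall>k. N n (\<lambda>x. u x - (\<Sum>i<k. h i x $ j)) \<le> (2 * (1 + (b - a))) ^ n * (\<Sum>i. N n (\<lambda>x. h (i + k) x $ j)))"
    using W_complete[OF vW_D[OF h] sj] by blast
  from choice[OF this] obtain u where u: "\<And>j. W n (u j)" "\<And>j k. N n (\<lambda>x. u j x - (\<Sum>i<k. h i x $ j)) \<le> (2 * (1 + (b - a))) ^ n * (\<Sum>i. N n (\<lambda>x. h (i + k) x $ j))"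
    by blast
  define v where "v = (\<lambda>x. \<chi> j. u j x)"
  have "vN n (\<lambda>x. v x - (\<Sum>i<k. h i x)) \<le> (2 * (1 + (b - a))) ^ n * (\<Sum>i. vN n (h (i + k)))" for k
  proof -
    have "vN n (\<lambda>x. v x - (\<Sum>i<k. h i x)) \<le> (\<Sum>j\<in>UNIV. (2 * (1 + (b - a))) ^ n * (\<Sum>i. N n (\<lambda>x. h (i + k) x $ j)))"
      unfolding vW_norm_def by (rule sum_mono) (use u in \<open>simp add: v_def\<close>)
    also have "\<dots> = (2 * (1 + (b - a))) ^ n * (\<Sum>i. vN n (h (i + k)))"
      unfolding vW_norm_def sum_distrib_left[symmetric]
      by (subst suminf_sum) (auto intro: summable_ignore_initial_segment[OF sj])
    finally show ?thesis .
  qed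
  moreover have "vW n v" using u by (simp add: vW_inf_def v_def)
  ultimately show ?thesis by blast
qed

section \<open>Linear systems as integral equations\<close>

lemma vW_AE_bound: "vW n f \<Longrightarrow> AEI (\<lambda>x. norm (f x) \<le> vN n f)"
proof -
  assume f: "vW n f"
  have "AE x in lebesgue. \<forall>i. x \<in> {a..b} \<longrightarrow> norm (f x $ i) \<le> N n (\<lambda>x. f x $ i)"
    by (simp only: AE_all_countable, intro allI W_AE_bound[OF vW_D[OF f]])
  then show ?thesis
  proof eventually_elim
    case (elim x)
    show ?case
    proof
      assume "x \<in> {a..b}"
      then have "(\<Sum>i\<in>UNIV. norm (f x $ i)) \<le> vN n f"
        unfolding vW_norm_def using elim by (intro sum_mono) auto
      then show "norm (f x) \<le> vN n f" using norm_le_sum_nth[of "f x"] by linarith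
    qed
  qed
qed

lemma mW_AE_bound: "mW n A \<Longrightarrow> AEI (\<lambda>x. \<forall>v. norm (A x *v v) \<le> mN n A * norm v)"
proof -
  assume A: "mW n A"
  have "AE x in lebesgue. \<forall>i. \<forall>j. x \<in> {a..b} \<longrightarrow> norm (A x $ i $ j) \<le> N n (\<lambda>x. A x $ i $ j)"
    by (simp only: AE_all_countable, intro allI W_AE_bound[OF mW_D[OF A]])
  then show ?thesis
  proof eventually_elim
    case (elim x)
    show ?case
    proof (intro impI allI)
      fix v assume "x \<in> {a..b}"
      then have "(\<Sum>i\<in>UNIV. \<Sum>j\<in>UNIV. norm (A x $ i $ j)) \<le> mN n A"
        unfolding mW_norm_def using elim by (intro sum_mono) auto
      then show "norm (A x *v v) \<le> mN n A * norm v"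
        using norm_matvec_le[of "A x" v] mult_right_mono[OF _ norm_ge_zero[of v]] order_trans by blast
    qed
  qed
qed

lemma vW_integrable:
  fixes g :: "real \<Rightarrow> complex ^ 'm"
  assumes g: "vW n g" and "x \<le> b"
  shows "g integrable_on {a..x}"
proof -
  have "bounded_linear (axis i :: complex \<Rightarrow> complex ^ 'm)" for i
    unfolding linear_conv_bounded_linear[symmetric]
    by (rule linearI) (auto simp: vec_eq_iff axis_def)
  then have "(\<lambda>s. \<Sum>i\<in>UNIV. axis i (g s $ i)) integrable_on {a..x}"
    using integrable_linear[OF W_integrable[OF vW_D[OF g] assms(2)]]
    by (intro integrable_sum) (auto simp: o_def)
  moreover have "(\<Sum>i\<in>UNIV. axis i (g s $ i)) = g s" for s
    by (simp add: vec_eq_iff axis_def)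
  ultimately show ?thesis by simp
qed

lemma integral_vW_nth:
  "vW n g \<Longrightarrow> x \<le> b \<Longrightarrow> integral {a..x} g $ i = integral {a..x} (\<lambda>s. g s $ i)"
  using integral_linear[OF vW_integrable bounded_linear_vec_nth, of n g x i] by (simp add: o_def)

lemma vW_primitive:
  assumes g: "vW n g" and u: "\<And>x. x \<in> {a..b} \<Longrightarrow> u x = \<alpha> + integral {a..x} g"
  shows "vW (Suc n) u" and "vN (Suc n) u = vN 0 u + vN n g"
proof -
  have eq: "u x $ i = \<alpha> $ i + integral {a..x} (\<lambda>s. g s $ i)" if "x \<in> {a..b}" for x i
    using u[OF that] integral_vW_nth[OF g] that by simp
  show "vW (Suc n) u"
    unfolding vW_inf_def by (intro allI W_primitive(1)[OF vW_D[OF g] eq])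
  have "N (Suc n) (\<lambda>x. u x $ i) = N 0 (\<lambda>x. u x $ i) + N n (\<lambda>x. g x $ i)" for i
    unfolding N_0 by (rule N_primitive[OF vW_D[OF g] eq])
  then show "vN (Suc n) u = vN 0 u + vN n g"
    by (simp add: vW_norm_def sum.distrib)
qed

lemma vW_residual:
  assumes "mW n A" "vW n f" "vW n y" shows "vW n (\<lambda>x. f x - A x *v y x)"
  by (rule vW_N_diff(1)[OF assms(2) vW_N_matvec(1)[OF assms(1,3)]])

lemma vW_0_continuous: "continuous_on {a..b} y \<Longrightarrow> vW 0 y"
  unfolding vW_inf_def by (intro allI continuous_imp_W0 continuous_intros)

lemma vW_Suc_continuous:
  assumes "vW (Suc n) y" shows "continuous_on {a..b} y"
proof -
  have "continuous_on {a..b} (\<lambda>x. \<chi> i. y x $ i)"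
    by (intro continuous_on_vec_lambda W_Suc_continuous[OF vW_D[OF assms]])
  then show ?thesis by simp
qed

text \<open>A differential equation almost everywhere does not determine increments by itself, as
  the Cantor function shows. Membership of \<open>y\<close> in \<open>vW (Suc k)\<close> makes each
  component the integral of its derivative, and this derivative is the residual almost
  everywhere.\<close>

lemma solves_ode_integral_eq:
  assumes A: "mW k A" and f: "vW k f" and y: "vW (Suc k) y" and sol: "solves_ode a b A f y" and x: "x \<in> {a..b}"
  shows "y x = y a + integral {a..x} (\<lambda>s. f s - A s *v y s)"
proof -
  let ?r = "\<lambda>s. f s - A s *v y s"
  have r: "vW k ?r" by (rule vW_residual[OF A f vW_mono[OF _ y]]) simp
  have "y x $ i = y a $ i + integral {a..x} (\<lambda>s. ?r s $ i)" for i
  proof -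
    have "AE x in lebesgue. x \<in> {a<..<b} \<longrightarrow> ((\<lambda>x. y x $ i) has_vector_derivative ?r x $ i) (at x)"
      using sol unfolding solves_ode_def
    proof eventually_elim
      case (elim x)
      then show ?case
        using bounded_linear.has_vector_derivative[OF bounded_linear_vec_nth[of i], of y "?r x" "at x"] by blast
    qed
    from AEI_negligible[OF wderiv_eq_AE[OF this]] obtain S where S: "negligible S"
      "\<And>x. x \<in> {a..b} - S \<Longrightarrow> wderiv (\<lambda>x. y x $ i) x = ?r x $ i" by blast
    have "integral {a..x} (wderiv (\<lambda>x. y x $ i)) = integral {a..x} (\<lambda>s. ?r s $ i)"
      by (rule integral_spike[OF S(1)]) (use S(2) x in auto)
    then show ?thesis using W_Suc_D(3)[OF vW_D[OF y] x, of i] by simp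
  qed
  then show ?thesis using integral_vW_nth[OF r] x by (simp add: vec_eq_iff)
qed

text \<open>Bootstrapping: if \<open>y\<close> has order \<open>j\<close>, so has the integrand, and
  its primitive \<open>y\<close> has order \<open>Suc j\<close>. The regularity of \<open>A\<close>
  and \<open>f\<close> stops this at \<open>Suc k\<close>.\<close>

lemma integral_eq_solves_ode:
  assumes A: "mW k A" and f: "vW k f" and y: "continuous_on {a..b} y"
    and eq: "\<And>x. x \<in> {a..b} \<Longrightarrow> y x = \<eta> + integral {a..x} (\<lambda>s. f s - A s *v y s)"
  shows "vW (Suc k) y" "solves_ode a b A f y" "y a = \<eta>"
proof -
  have W: "vW j y" if "j \<le> Suc k" for j
    using that
  proof (induction j)
    case 0 then show ?case using vW_0_continuous[OF y] by simp
  next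
    case (Suc j)
    then have "vW j (\<lambda>s. f s - A s *v y s)"
      by (intro vW_residual mW_mono[OF _ A] vW_mono[OF _ f]) auto
    then show ?case by (rule vW_primitive(1)[OF _ eq])
  qed
  then show "vW (Suc k) y" by simp
  show "y a = \<eta>" using eq[of a] ab by simp
  have r: "vW k (\<lambda>s. f s - A s *v y s)" by (rule vW_residual[OF A f W]) simp
  show "solves_ode a b A f y"
    unfolding solves_ode_def by (rule primitive_has_derivative_AE[OF vW_integrable[OF r order_refl] eq])
qed

text \<open>The factor \<open>1 / \<kappa>\<close> gained by integrating the weight is what makes
  the coefficient term small, however long the interval and however large the coefficient.\<close>

lemma exp_weight_integral:
  assumes "\<kappa> > 0" "a \<le> x"
  shows "(\<lambda>s. exp (\<kappa> * (s - a))) integrable_on {a..x}"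
    and "integral {a..x} (\<lambda>s. exp (\<kappa> * (s - a))) \<le> exp (\<kappa> * (x - a)) / \<kappa>"
proof -
  have "((\<lambda>s. exp (\<kappa> * (s - a))) has_integral (exp (\<kappa> * (x - a)) / \<kappa> - exp (\<kappa> * (a - a)) / \<kappa>)) {a..x}"
    using assms by (intro fundamental_theorem_of_calculus)
      (auto intro!: derivative_eq_intros simp: has_real_derivative_iff_has_vector_derivative[symmetric])
  then show "(\<lambda>s. exp (\<kappa> * (s - a))) integrable_on {a..x}"
    "integral {a..x} (\<lambda>s. exp (\<kappa> * (s - a))) \<le> exp (\<kappa> * (x - a)) / \<kappa>"
    using assms by (auto simp: integral_unique)
qed

text \<open>Gronwall's inequality, by absorbing the maximum of \<open>exp (- \<kappa> * (x - a)) * norm (y x)\<close>.\<close>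

lemma solves_ode_sup_bound:
  fixes A :: "real \<Rightarrow> complex ^ 'm ^ 'm"
  assumes A: "mW k A"
  shows "\<exists>C\<ge>0. \<forall>f y. vW k f \<longrightarrow> vW (Suc k) y \<longrightarrow> solves_ode a b A f y \<longrightarrow>
           (\<forall>x\<in>{a..b}. norm (y x) \<le> C * (norm (y a) + vN k f))"
proof -
  define R where "R = mN k A"
  \<comment> \<open>Chosen so that \<open>R / \<kappa> \<le> 1 / 2\<close>, which leaves half of the
    maximum after absorption; the summand 1 keeps \<kappa> positive when
    \<open>R = 0\<close>.\<close>
  define \<kappa> where "\<kappa> = 2 * R + 1"
  have R: "R \<ge> 0" unfolding R_def by (rule mN_nonneg[OF A])
  have \<kappa>: "\<kappa> > 0" "R / \<kappa> \<le> 1 / 2" using R by (auto simp: \<kappa>_def field_simps)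
  define d where "d = b - a"
  have d: "d > 0" using ab by (simp add: d_def)
  have main: "norm (y x) \<le> exp (\<kappa> * d) * (2 * (1 + d)) * (norm (y a) + vN k f)"
    if f: "vW k f" and y: "vW (Suc k) y" and sol: "solves_ode a b A f y" and x: "x \<in> {a..b}" for f x and y :: "real \<Rightarrow> complex ^ 'm"
  proof -
    define F where "F = vN k f"
    have F: "F \<ge> 0" unfolding F_def by (rule vN_nonneg[OF f])
    define \<phi> where "\<phi> = (\<lambda>x. exp (- \<kappa> * (x - a)) * norm (y x))"
    have "continuous_on {a..b} \<phi>"
      unfolding \<phi>_def by (intro continuous_intros vW_Suc_continuous[OF y])
    then obtain x0 where x0: "x0 \<in> {a..b}" "\<And>x. x \<in> {a..b} \<Longrightarrow> \<phi> x \<le> \<phi> x0"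
      using continuous_attains_sup[of "{a..b}" \<phi>] ab by auto
    define M where "M = \<phi> x0"
    have M: "M \<ge> 0" by (simp add: M_def \<phi>_def)
    have yM: "norm (y x) \<le> exp (\<kappa> * (x - a)) * M" if "x \<in> {a..b}" for x
    proof -
      have "norm (y x) = exp (\<kappa> * (x - a)) * \<phi> x" by (simp add: \<phi>_def exp_minus)
      then show ?thesis using x0(2)[OF that] by (simp add: M_def)
    qed
    let ?r = "\<lambda>s. f s - A s *v y s"
    have r: "vW k ?r" by (rule vW_residual[OF A f vW_mono[OF _ y]]) simp
    have ae: "AEI (\<lambda>s. norm (?r s) \<le> F + R * M * exp (\<kappa> * (s - a)))"
      using vW_AE_bound[OF f] mW_AE_bound[OF A]
    proof eventually_elim
      case (elim s)
      show ?case
      proof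
        assume s: "s \<in> {a..b}"
        have "norm (?r s) \<le> norm (f s) + norm (A s *v y s)" by (rule norm_triangle_ineq4)
        also have "norm (A s *v y s) \<le> R * norm (y s)" using elim s by (simp add: R_def)
        also have "R * norm (y s) \<le> R * (exp (\<kappa> * (s - a)) * M)" by (rule mult_left_mono[OF yM[OF s] R])
        finally show "norm (?r s) \<le> F + R * M * exp (\<kappa> * (s - a))"
          using elim s by (simp add: F_def mult_ac)
      qed
    qed
    have bd: "norm (y x) \<le> norm (y a) + d * F + M / 2 * exp (\<kappa> * (x - a))" if x: "x \<in> {a..b}" for x
    proof -
      have ax: "a \<le> x" using x by simp
      note e = exp_weight_integral[OF \<kappa>(1) ax]
      have e': "(\<lambda>s. R * M * exp (\<kappa> * (s - a))) integrable_on {a..x}"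
        using integrable_cmul[OF e(1), of "R * M"] by simp
      have "norm (integral {a..x} ?r) \<le> integral {a..x} (\<lambda>s. F + R * M * exp (\<kappa> * (s - a)))"
        by (rule norm_integral_le_AEI[OF vW_integrable[OF r] ae])
          (use x e' in \<open>auto intro!: integrable_add\<close>)
      also have "\<dots> = (x - a) * F + R * M * integral {a..x} (\<lambda>s. exp (\<kappa> * (s - a)))"
        using e' ax by (subst integral_add) auto
      also have "\<dots> \<le> d * F + R * M * (exp (\<kappa> * (x - a)) / \<kappa>)"
        using x F R M e by (intro add_mono mult_right_mono mult_left_mono) (auto simp: d_def)
      also have "R * M * (exp (\<kappa> * (x - a)) / \<kappa>) = (R / \<kappa>) * (M * exp (\<kappa> * (x - a)))" by simp
      also have "\<dots> \<le> 1 / 2 * (M * exp (\<kappa> * (x - a)))" by (rule mult_right_mono[OF \<kappa>(2)]) (use M in simp)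
      finally have i: "norm (integral {a..x} ?r) \<le> d * F + M / 2 * exp (\<kappa> * (x - a))" by simp
      have "y x = y a + integral {a..x} ?r" by (rule solves_ode_integral_eq[OF A f y sol x])
      then have "norm (y x) \<le> norm (y a) + norm (integral {a..x} ?r)" by (metis norm_triangle_ineq)
      with i show ?thesis by linarith
    qed
    define c where "c = norm (y a) + d * F"
    have c: "c \<ge> 0" using d F by (simp add: c_def)
    have "M = exp (- \<kappa> * (x0 - a)) * norm (y x0)" by (simp add: M_def \<phi>_def)
    also have "\<dots> \<le> exp (- \<kappa> * (x0 - a)) * (c + M / 2 * exp (\<kappa> * (x0 - a)))"
      using bd[OF x0(1)] by (intro mult_left_mono) (auto simp: c_def)
    also have "\<dots> = exp (- \<kappa> * (x0 - a)) * c + M / 2" by (simp add: distrib_left exp_minus)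
    also have "exp (- \<kappa> * (x0 - a)) * c \<le> 1 * c"
      using \<kappa> x0(1) c by (intro mult_right_mono) (auto simp: mult_nonneg_nonpos)
    finally have M2: "M \<le> 2 * c" by simp
    have "norm (y x) \<le> exp (\<kappa> * (x - a)) * M" by (rule yM[OF x])
    also have "\<dots> \<le> exp (\<kappa> * d) * (2 * c)"
      using M2 M x \<kappa> by (intro mult_mono) (auto simp: d_def)
    also have "2 * c \<le> 2 * (1 + d) * (norm (y a) + F)"
      using d F by (simp add: c_def algebra_simps)
    finally show ?thesis by (simp add: F_def mult.assoc)
  qed
  show ?thesis
    by (rule exI[of _ "exp (\<kappa> * d) * (2 * (1 + d))"]) (use main d in auto)
qed

text \<open>The equation expresses \<open>y'\<close> through \<open>f\<close> and
  \<open>A y\<close>, so a bound of order \<open>j\<close> yields one of order \<open>Suc j\<close>.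
  In the new constant \<open>C\<close> accounts for the sup norm of \<open>y\<close>, 1 for
  \<open>f\<close>, and \<open>2 ^ j * mN k A * C\<close> for the product. The induction starts from
  the sup bound.\<close>

lemma solves_ode_norm_bound:
  fixes A :: "real \<Rightarrow> complex ^ 'm ^ 'm"
  assumes A: "mW k A"
  shows "\<exists>C\<ge>0. \<forall>f y. vW k f \<longrightarrow> vW (Suc k) y \<longrightarrow> solves_ode a b A f y \<longrightarrow>
           vN (Suc k) y \<le> C * (norm (y a) + vN k f)"
proof -
  obtain C0 where C0: "C0 \<ge> 0" "\<And>f y x. vW k f \<Longrightarrow> vW (Suc k) y \<Longrightarrow> solves_ode a b A f y \<Longrightarrow>
     x \<in> {a..b} \<Longrightarrow> norm (y x) \<le> C0 * (norm (y a) + vN k f)"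
    using solves_ode_sup_bound[OF A] by blast
  have "j \<le> Suc k \<Longrightarrow> \<exists>C\<ge>0. \<forall>f y. vW k f \<longrightarrow> vW (Suc k) y \<longrightarrow> solves_ode a b A f y \<longrightarrow>
           vN j y \<le> C * (norm (y a) + vN k f)" for j
  proof (induction j)
    case 0
    have "vN 0 y \<le> (real CARD('m) * C0) * (norm (y a) + vN k f)"
      if f: "vW k f" and y: "vW (Suc k) y" and sol: "solves_ode a b A f y" for f and y :: "real \<Rightarrow> complex ^ 'm"
    proof -
      have "vN 0 y \<le> (\<Sum>i\<in>(UNIV::'m set). C0 * (norm (y a) + vN k f))"
        unfolding vW_norm_def N_0
      proof (intro sum_mono Linf_le AE_I2 impI)
        fix i x assume "x \<in> {a..b}"
        from C0(2)[OF f y sol this] Finite_Cartesian_Product.norm_nth_le[of "y x" i]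
        show "norm (y x $ i) \<le> C0 * (norm (y a) + (\<Sum>i\<in>UNIV. N k (\<lambda>x. f x $ i)))"
          by (simp add: vW_norm_def)
      qed
      then show ?thesis by simp
    qed
    then show ?case using C0(1) by (intro exI[of _ "real CARD('m) * C0"]) auto
  next
    case (Suc j)
    then have j: "j \<le> k" "j \<le> Suc k" by auto
    obtain C where C: "C \<ge> 0" "\<And>f y. vW k f \<Longrightarrow> vW (Suc k) y \<Longrightarrow> solves_ode a b A f y \<Longrightarrow>
           vN j y \<le> C * (norm (y a) + vN k f)"
      using Suc.IH j by blast
    define D where "D = C + 1 + 2 ^ j * mN k A * C"
    have "vN (Suc j) y \<le> D * (norm (y a) + vN k f)"
      if f: "vW k f" and y: "vW (Suc k) y" and sol: "solves_ode a b A f y" for f and y :: "real \<Rightarrow> complex ^ 'm"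
    proof -
      define T where "T = norm (y a) + vN k f"
      have yj: "vW j y" by (rule vW_mono[OF j(2) y])
      have Aj: "mW j A" and fj: "vW j f" by (rule mW_mono[OF j(1) A], rule vW_mono[OF j(1) f])
      have le: "vN j y \<le> C * T" using C(2)[OF f y sol] by (simp add: T_def)
      have T: "T \<ge> 0" using vN_nonneg[OF f] by (simp add: T_def)
      have "vN (Suc j) y = vN 0 y + vN j (\<lambda>s. f s - A s *v y s)"
        by (rule vW_primitive(2)[OF vW_residual[OF Aj fj yj] solves_ode_integral_eq[OF A f y sol]])
      also have "vN 0 y \<le> C * T" using vN_mono[of 0 j y] yj le by simp
      also have "vN j (\<lambda>s. f s - A s *v y s) \<le> vN j f + vN j (\<lambda>s. A s *v y s)"
        by (rule vW_N_diff(2)[OF fj vW_N_matvec(1)[OF Aj yj]])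
      also have "vN j f \<le> T" using vN_mono[OF j(1) f] norm_ge_zero[of "y a"] unfolding T_def by linarith
      also have "vN j (\<lambda>s. A s *v y s) \<le> 2 ^ j * mN j A * vN j y" by (rule vW_N_matvec(2)[OF Aj yj])
      also have "\<dots> \<le> 2 ^ j * mN k A * (C * T)"
        by (intro mult_mono mult_left_mono le mN_mono[OF j(1) A] mult_nonneg_nonneg vN_nonneg[OF yj] mN_nonneg[OF A]) auto
      finally show ?thesis by (simp add: D_def T_def algebra_simps)
    qed
    moreover have "D \<ge> 0" using C(1) mN_nonneg[OF A] by (simp add: D_def)
    ultimately show ?case by blast
  qed
  then show ?thesis by blast
qed

text \<open>Clamping the argument embeds the continuous functions on \<open>{a..b}\<close> into the
  complete space of bounded continuous functions on the line, where Banach's fixed point theorem is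
  applied.\<close>

lemma clamp_bcontfun:
  fixes g :: "real \<Rightarrow> 'e::metric_space"
  assumes "continuous_on {a..b} g"
  shows "(\<lambda>x. g (max a (min b x))) \<in> bcontfun"
proof -
  have "continuous_on UNIV (\<lambda>x. g (max a (min b x)))"
    by (rule continuous_on_compose2[OF assms]) (use ab in \<open>auto intro!: continuous_intros\<close>)
  moreover have "bounded (range (\<lambda>x. g (max a (min b x))))"
    by (rule bounded_subset[OF compact_imp_bounded[OF compact_continuous_image[OF assms compact_Icc]]])
      (use ab in auto)
  ultimately show ?thesis by (simp add: bcontfun_def)
qed

text \<open>Writing the solution as \<open>exp (\<kappa> * (x - a)) *\<^sub>R v x\<close> makes the Picard operator a contraction on
  the whole interval.\<close>

lemma ode_solution_exists:
  fixes A :: "real \<Rightarrow> complex ^ 'm ^ 'm"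
  assumes A: "mW k A" and f: "vW k f"
  shows "\<exists>y. vW (Suc k) y \<and> solves_ode a b A f y \<and> y a = \<eta>"
proof -
  define R where "R = mN k A"
  define \<kappa> where "\<kappa> = 2 * R + 1"
  have R: "R \<ge> 0" unfolding R_def by (rule mN_nonneg[OF A])
  have \<kappa>: "\<kappa> > 0" "R / \<kappa> \<le> 1 / 2" using R by (auto simp: \<kappa>_def field_simps)
  define r :: "(real \<Rightarrow>\<^sub>C (complex ^ 'm)) \<Rightarrow> real \<Rightarrow> complex ^ 'm"
    where "r = (\<lambda>v s. f s - A s *v (exp (\<kappa> * (s - a)) *\<^sub>R apply_bcontfun v s))"
  define g where "g = (\<lambda>v x. exp (- \<kappa> * (x - a)) *\<^sub>R (\<eta> + integral {a..x} (r v)))"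
  define T where "T = (\<lambda>v. Bcontfun (\<lambda>x. g v (max a (min b x))))"
  have ri: "r v integrable_on {a..x}" if "x \<le> b" for v x
    unfolding r_def
    by (rule vW_integrable[OF vW_residual[OF mW_mono[OF _ A] vW_mono[OF _ f] vW_0_continuous] that])
      (auto intro!: continuous_intros)
  have T: "apply_bcontfun (T v) x = g v (max a (min b x))" for v x
  proof -
    have "continuous_on {a..b} (g v)"
      unfolding g_def by (intro continuous_intros indefinite_integral_continuous_1 ri) simp
    from clamp_bcontfun[OF this] show ?thesis by (simp add: T_def Bcontfun_inverse)
  qed
  \<comment> \<open>The inner weight integrates to at most
    \<open>exp (\<kappa> * (t - a)) / \<kappa>\<close>, the outer weight cancels the exponential,
    and \<open>R / \<kappa> \<le> 1 / 2\<close> remains.\<close>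
  have "\<forall>v w. dist (T v) (T w) \<le> 1 / 2 * dist v w"
  proof (intro allI dist_bound)
    fix v w x
    define t where "t = max a (min b x)"
    have t: "a \<le> t" "t \<le> b" using ab by (auto simp: t_def)
    note e = exp_weight_integral[OF \<kappa>(1) t(1)]
    have ae: "AEI (\<lambda>s. norm (r v s - r w s) \<le> R * dist v w * exp (\<kappa> * (s - a)))"
      using mW_AE_bound[OF A]
    proof eventually_elim
      case (elim s)
      show ?case
      proof
        assume s: "s \<in> {a..b}"
        have "r v s - r w s = A s *v (exp (\<kappa> * (s - a)) *\<^sub>R (apply_bcontfun w s - apply_bcontfun v s))"
          by (simp add: r_def matrix_vector_mult_diff_distrib scaleR_diff_right)
        also have "norm \<dots> \<le> R * norm (exp (\<kappa> * (s - a)) *\<^sub>R (apply_bcontfun w s - apply_bcontfun v s))"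
          using elim s unfolding R_def by blast
        also have "\<dots> \<le> R * (exp (\<kappa> * (s - a)) * dist v w)"
          by (rule mult_left_mono[OF _ R]) (use dist_bounded[of v s w] in \<open>simp add: dist_norm norm_minus_commute\<close>)
        finally show "norm (r v s - r w s) \<le> R * dist v w * exp (\<kappa> * (s - a))" by (simp add: mult_ac)
      qed
    qed
    have "g v t - g w t = exp (- \<kappa> * (t - a)) *\<^sub>R integral {a..t} (\<lambda>s. r v s - r w s)"
      using ri[OF t(2)] by (simp add: g_def integral_diff flip: scaleR_diff_right)
    also have "norm \<dots> = exp (- \<kappa> * (t - a)) * norm (integral {a..t} (\<lambda>s. r v s - r w s))" by simp
    also have "norm (integral {a..t} (\<lambda>s. r v s - r w s)) \<le> integral {a..t} (\<lambda>s. R * dist v w * exp (\<kappa> * (s - a)))"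
      by (rule norm_integral_le_AEI[OF integrable_diff[OF ri[OF t(2)] ri[OF t(2)]] ae])
        (use t integrable_cmul[OF e(1), of "R * dist v w"] in auto)
    also have "\<dots> = R * dist v w * integral {a..t} (\<lambda>s. exp (\<kappa> * (s - a)))" by simp
    also have "\<dots> \<le> R * dist v w * (exp (\<kappa> * (t - a)) / \<kappa>)"
      by (rule mult_left_mono[OF e(2)]) (use R in simp)
    also have "exp (- \<kappa> * (t - a)) * (R * dist v w * (exp (\<kappa> * (t - a)) / \<kappa>)) = (R / \<kappa>) * dist v w"
      by (simp add: exp_minus)
    also have "\<dots> \<le> 1 / 2 * dist v w" by (rule mult_right_mono[OF \<kappa>(2)]) simp
    finally show "dist (apply_bcontfun (T v) x) (apply_bcontfun (T w) x) \<le> 1 / 2 * dist v w"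
      by (simp add: T t_def dist_norm)
  qed
  then obtain v where v: "T v = v"
    using banach_fix_type[of "1 / 2" T] by auto
  define y where "y = (\<lambda>x. exp (\<kappa> * (x - a)) *\<^sub>R apply_bcontfun v x)"
  have eq: "y x = \<eta> + integral {a..x} (\<lambda>s. f s - A s *v y s)" if x: "x \<in> {a..b}" for x
  proof -
    have "apply_bcontfun v x = g v x" using T[of v x] x unfolding v by simp
    then have "y x = \<eta> + integral {a..x} (r v)"
      by (simp add: y_def g_def exp_minus)
    then show ?thesis by (simp add: r_def y_def)
  qed
  have "continuous_on {a..b} y" unfolding y_def by (intro continuous_intros) auto
  from integral_eq_solves_ode[OF A f this eq] show ?thesis by blast
qed

lemma solves_ode_add:
  assumes "solves_ode a b A f y" "solves_ode a b A g z"
  shows "solves_ode a b A (\<lambda>x. f x + g x) (\<lambda>x. y x + z x)"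
  using assms unfolding solves_ode_def
proof eventually_elim
  case (elim x)
  show ?case
  proof
    assume "x \<in> {a<..<b}"
    then have "((\<lambda>x. y x + z x) has_vector_derivative (f x - A x *v y x) + (g x - A x *v z x)) (at x)"
      using elim by (intro has_vector_derivative_add) auto
    then show "((\<lambda>x. y x + z x) has_vector_derivative f x + g x - A x *v (y x + z x)) (at x)"
      by (simp add: matrix_vector_right_distrib algebra_simps)
  qed
qed

lemma solves_ode_smult:
  assumes "solves_ode a b A f y"
  shows "solves_ode a b A (\<lambda>x. s *s f x) (\<lambda>x. s *s y x)"
  using assms unfolding solves_ode_def
proof eventually_elim
  case (elim x)
  have "linear ((*s) s :: complex ^ 'm \<Rightarrow> complex ^ 'm)"
    by (rule linearI) (auto simp: vec_eq_iff algebra_simps)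
  then have bl: "bounded_linear ((*s) s :: complex ^ 'm \<Rightarrow> complex ^ 'm)"
    by (simp add: linear_conv_bounded_linear)
  show ?case
  proof
    assume "x \<in> {a<..<b}"
    then have "((\<lambda>x. s *s y x) has_vector_derivative s *s (f x - A x *v y x)) (at x)"
      using elim by (intro bounded_linear.has_vector_derivative[OF bl]) auto
    then show "((\<lambda>x. s *s y x) has_vector_derivative s *s f x - A x *v (s *s y x)) (at x)"
      by (simp add: matvec_smult vector_ssub_ldistrib)
  qed
qed

lemma solves_ode_diff:
  assumes "solves_ode a b A f y" "solves_ode a b A g z"
  shows "solves_ode a b A (\<lambda>x. f x - g x) (\<lambda>x. y x - z x)"
proof -
  have m: "(-1) *s v = - v" for v :: "complex ^ 'm" by (simp add: vec_eq_iff)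
  show ?thesis using solves_ode_add[OF assms(1) solves_ode_smult[OF assms(2), of "-1"]] by (simp add: m)
qed

text \<open>Moves a change of coefficient into the right-hand side, so that estimates for one
  coefficient apply to solutions for another.\<close>

lemma solves_ode_change_coeff:
  "solves_ode a b A f y \<Longrightarrow> solves_ode a b A' (\<lambda>x. f x - (A x - A' x) *v y x) y"
  unfolding solves_ode_def by (simp add: matrix_vector_mult_diff_rdistrib)

lemma vN_Suc_eq_0:
  assumes y: "vW (Suc k) y" and "vN (Suc k) y \<le> 0" and x: "x \<in> {a..b}"
  shows "y x = 0"
proof -
  have "N (Suc k) (\<lambda>x. y x $ i) \<le> vN (Suc k) y" for i
    unfolding vW_norm_def by (rule member_le_sum) (auto intro: N_nonneg vW_D[OF y])
  then have "N (Suc k) (\<lambda>x. y x $ i) \<le> 0" for i using assms(2) order_trans by blast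
  then have "norm (y x $ i) \<le> 0" for i
    using order_trans[OF W_Suc_pointwise[OF vW_D[OF y] x, of i] mult_nonneg_nonpos] ab by simp
  then show ?thesis by (simp add: vec_eq_iff)
qed

lemma vN_eq_0:
  fixes y :: "real \<Rightarrow> complex ^ 'm"
  assumes "\<And>x. x \<in> {a..b} \<Longrightarrow> y x = 0" shows "vW n y" "vN n y = 0"
proof -
  have *: "sob_eq n (\<lambda>x. (\<lambda>_. 0 :: complex ^ 'm) x $ i) (\<lambda>x. y x $ i)" for i
    using assms by (intro sob_eqI) simp
  have 0: "vW n (\<lambda>_. 0 :: complex ^ 'm)" by (rule vW_const)
  show "vW n y" unfolding vW_inf_def using W_N_cong(1)[OF * vW_D[OF 0]] by blast
  have "vN n y = vN n (\<lambda>_. 0 :: complex ^ 'm)"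
    unfolding vW_norm_def by (rule sum.cong[OF refl]) (rule W_N_cong(2)[OF * vW_D[OF 0]])
  then show "vN n y = 0" by (simp add: vN_zero)
qed

section \<open>Boundary operators and the boundary value problem\<close>

lemma bounded_linear_W_D:
  assumes "bounded_linear_W a b n B"
  shows "vW n y \<Longrightarrow> vW n z \<Longrightarrow> B (\<lambda>x. y x + z x) = B y + B z"
    and "vW n y \<Longrightarrow> B (\<lambda>x. s *s y x) = s *s B y"
    and "\<exists>K\<ge>0. \<forall>y. vW n y \<longrightarrow> norm (B y) \<le> K * vN n y"
proof -
  show "vW n y \<Longrightarrow> vW n z \<Longrightarrow> B (\<lambda>x. y x + z x) = B y + B z"
    and "vW n y \<Longrightarrow> B (\<lambda>x. s *s y x) = s *s B y"
    using assms unfolding bounded_linear_W_def by blast+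
  obtain K where K: "\<And>y. vW n y \<Longrightarrow> norm (B y) \<le> K * vN n y"
    using assms unfolding bounded_linear_W_def by blast
  have "norm (B y) \<le> max K 0 * vN n y" if "vW n y" for y
    by (rule order_trans[OF K[OF that] mult_right_mono[OF _ vN_nonneg[OF that]]]) simp
  then show "\<exists>K\<ge>0. \<forall>y. vW n y \<longrightarrow> norm (B y) \<le> K * vN n y"
    by (intro exI[of _ "max K 0"]) auto
qed

lemma bounded_linear_W_diff:
  assumes B: "bounded_linear_W a b n B" and y: "vW n y" and z: "vW n z"
  shows "B (\<lambda>x. y x - z x) = B y - B z"
proof -
  have m: "(-1) *s v = - v" for v :: "complex ^ 'm" by (simp add: vec_eq_iff)
  show ?thesis
    using bounded_linear_W_D(1)[OF B y vW_N_cmul(1)[OF z, of "-1"]] bounded_linear_W_D(2)[OF B z, of "-1"]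
    by (simp add: m)
qed

text \<open>\<open>B\<close> is applied to total functions, yet its boundedness prevents it from
  seeing values outside \<open>{a..b}\<close>: a difference vanishing on the interval has norm
  0.\<close>

lemma bounded_linear_W_cong:
  assumes B: "bounded_linear_W a b n B" and y: "vW n y" and z: "vW n z"
    and eq: "\<And>x. x \<in> {a..b} \<Longrightarrow> y x = z x"
  shows "B y = B z"
proof -
  obtain K where K: "\<And>y. vW n y \<Longrightarrow> norm (B y) \<le> K * vN n y"
    using bounded_linear_W_D(3)[OF B] by blast
  have "norm (B (\<lambda>x. y x - z x)) \<le> K * vN n (\<lambda>x. y x - z x)"
    by (rule K[OF vW_N_diff(1)[OF y z]])
  also have "vN n (\<lambda>x. y x - z x) = 0" by (rule vN_eq_0(2)) (simp add: eq)
  finally show ?thesis using bounded_linear_W_diff[OF B y z] by simp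
qed

lemma solves_ode_unique:
  assumes A: "mW k A" and f: "vW k f" and y: "vW (Suc k) y" "solves_ode a b A f y"
    and z: "vW (Suc k) z" "solves_ode a b A f z" and eq: "y a = z a" and x: "x \<in> {a..b}"
  shows "y x = z x"
proof -
  obtain C where "\<And>f y x. vW k f \<Longrightarrow> vW (Suc k) y \<Longrightarrow> solves_ode a b A f y \<Longrightarrow> x \<in> {a..b} \<Longrightarrow>
      norm (y x) \<le> C * (norm (y a) + vN k f)"
    using solves_ode_sup_bound[OF A] by blast
  from this[OF vW_N_diff(1)[OF f f] vW_N_diff(1)[OF y(1) z(1)] solves_ode_diff[OF y(2) z(2)] x]
  have "norm (y x - z x) \<le> 0" using eq by (simp add: vN_zero)
  then show ?thesis by simp
qed

text \<open>The fundamental matrix normalised at \<open>a\<close>, applied to \<eta>. Being chosen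
  by \<open>SOME\<close>, its values outside \<open>{a..b}\<close> are arbitrary.\<close>

definition fundamental :: "nat \<Rightarrow> (real \<Rightarrow> complex ^ 'm ^ 'm) \<Rightarrow> complex ^ 'm \<Rightarrow> real \<Rightarrow> complex ^ 'm" where
  "fundamental k A \<eta> = (SOME y. vW (Suc k) y \<and> solves_ode a b A (\<lambda>_. 0) y \<and> y a = \<eta>)"

lemma fundamental:
  assumes A: "mW k A"
  shows "vW (Suc k) (fundamental k A \<eta>)" "solves_ode a b A (\<lambda>_. 0) (fundamental k A \<eta>)" "fundamental k A \<eta> a = \<eta>"
  using someI_ex[OF ode_solution_exists[OF A vW_const[of k 0], of \<eta>]] unfolding fundamental_def by auto

text \<open>By uniqueness of the initial value problem, \<open>fundamental\<close> is linear in the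
  initial value on \<open>{a..b}\<close>; composing with \<open>B\<close> removes the dependence on
  the values elsewhere. Linearity over the reals is enough for the dimension count.\<close>

lemma linear_B_fundamental:
  fixes A :: "real \<Rightarrow> complex ^ 'm ^ 'm"
  assumes A: "mW k A" and B: "bounded_linear_W a b (Suc k) B"
  shows "linear (\<lambda>\<eta>. B (fundamental k A \<eta>))"
proof (rule linearI)
  note Y = fundamental[OF A]
  fix \<eta> \<zeta> :: "complex ^ 'm"
  have "B (fundamental k A (\<eta> + \<zeta>)) = B (\<lambda>x. fundamental k A \<eta> x + fundamental k A \<zeta> x)"
  proof (rule bounded_linear_W_cong[OF B Y(1) vW_N_add(1)[OF Y(1) Y(1)]])
    fix x assume "x \<in> {a..b}"
    then show "fundamental k A (\<eta> + \<zeta>) x = fundamental k A \<eta> x + fundamental k A \<zeta> x"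
      using solves_ode_add[OF Y(2)[of \<eta>] Y(2)[of \<zeta>]]
      by - (rule solves_ode_unique[OF A vW_const[of k 0] Y(1,2) vW_N_add(1)[OF Y(1) Y(1)]], simp_all add: Y(3))
  qed
  then show "B (fundamental k A (\<eta> + \<zeta>)) = B (fundamental k A \<eta>) + B (fundamental k A \<zeta>)"
    by (simp add: bounded_linear_W_D(1)[OF B Y(1) Y(1)])
next
  note Y = fundamental[OF A]
  fix c :: real and \<eta> :: "complex ^ 'm"
  have cs: "c *\<^sub>R v = of_real c *s v" for v :: "complex ^ 'm"
    unfolding vec_eq_iff vector_scaleR_component vector_smult_component by (simp add: scaleR_conv_of_real)
  have "B (fundamental k A (c *\<^sub>R \<eta>)) = B (\<lambda>x. of_real c *s fundamental k A \<eta> x)"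
  proof (rule bounded_linear_W_cong[OF B Y(1) vW_N_cmul(1)[OF Y(1)]])
    fix x assume "x \<in> {a..b}"
    then show "fundamental k A (c *\<^sub>R \<eta>) x = of_real c *s fundamental k A \<eta> x"
      using solves_ode_smult[OF Y(2)[of \<eta>], of "of_real c"]
      by - (rule solves_ode_unique[OF A vW_const[of k 0] Y(1,2) vW_N_cmul(1)[OF Y(1)]], simp_all add: Y(3) cs)
  qed
  then show "B (fundamental k A (c *\<^sub>R \<eta>)) = c *\<^sub>R B (fundamental k A \<eta>)"
    by (simp add: bounded_linear_W_D(2)[OF B Y(1)] cs)
qed

lemma inj_B_fundamental:
  assumes A: "mW k A" and B: "bounded_linear_W a b (Suc k) B"
    and uniq: "\<And>y. vW (Suc k) y \<Longrightarrow> solves_ode a b A (\<lambda>_. 0) y \<Longrightarrow> B y = 0 \<Longrightarrow> \<forall>x\<in>{a..b}. y x = 0"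
  shows "inj (\<lambda>\<eta>. B (fundamental k A \<eta>))"
  unfolding linear_injective_0[OF linear_B_fundamental[OF A B]]
proof (intro allI impI)
  fix \<eta> assume "B (fundamental k A \<eta>) = 0"
  then have "fundamental k A \<eta> a = 0"
    using uniq[OF fundamental(1,2)[OF A]] ab by auto
  then show "\<eta> = 0" by (simp add: fundamental(3)[OF A])
qed

text \<open>Initial values and boundary values range over the same finite-dimensional space, so
  injectivity of the map between them is surjectivity. A homogeneous solution then corrects the
  boundary value of any particular solution.\<close>

lemma bvp_solution_exists:
  assumes A: "mW k A" and B: "bounded_linear_W a b (Suc k) B"
    and uniq: "\<And>y. vW (Suc k) y \<Longrightarrow> solves_ode a b A (\<lambda>_. 0) y \<Longrightarrow> B y = 0 \<Longrightarrow> \<forall>x\<in>{a..b}. y x = 0"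
    and f: "vW k f"
  shows "\<exists>y. vW (Suc k) y \<and> solves_ode a b A f y \<and> B y = c"
proof -
  obtain p where p: "vW (Suc k) p" "solves_ode a b A f p"
    using ode_solution_exists[OF A f] by blast
  have "surj (\<lambda>\<eta>. B (fundamental k A \<eta>))"
    by (rule linear_injective_imp_surjective[OF linear_B_fundamental[OF A B] inj_B_fundamental[OF A B uniq]]) auto
  then obtain \<eta> where \<eta>: "c - B p = B (fundamental k A \<eta>)" by (metis surjD)
  let ?y = "\<lambda>x. p x + fundamental k A \<eta> x"
  have "vW (Suc k) ?y" by (rule vW_N_add(1)[OF p(1) fundamental(1)[OF A]])
  moreover have "solves_ode a b A f ?y"
    using solves_ode_add[OF p(2) fundamental(2)[OF A, of \<eta>]] by simp
  moreover have "B ?y = c"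
    using bounded_linear_W_D(1)[OF B p(1) fundamental(1)[OF A], of \<eta>] \<eta> by (simp add: algebra_simps)
  ultimately show ?thesis by blast
qed

section \<open>Uniform boundedness and the a priori estimate\<close>

text \<open>\<beta> is the operator norm, taken as a supremum over the unit ball. It need not be
  attained, hence the factor 1/2. As \<open>vN\<close> is a seminorm on total functions, elements of
  norm 0 cannot be normalised and are treated by boundedness directly.\<close>

lemma norming_element:
  assumes B: "bounded_linear_W a b n B"
  obtains \<beta> u where "\<beta> \<ge> 0" "\<And>y. vW n y \<Longrightarrow> norm (B y) \<le> \<beta> * vN n y"
    "vW n u" "vN n u \<le> 1" "norm (B u) \<ge> \<beta> / 2"
proof -
  define S where "S = {norm (B y) | y. vW n y \<and> vN n y \<le> 1}"
  obtain K where K: "K \<ge> 0" "\<And>y. vW n y \<Longrightarrow> norm (B y) \<le> K * vN n y"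
    using bounded_linear_W_D(3)[OF B] by blast
  have bdd: "bdd_above S"
  proof (rule bdd_aboveI)
    fix t assume "t \<in> S"
    then obtain y where "t = norm (B y)" "vW n y" "vN n y \<le> 1" by (auto simp: S_def)
    then show "t \<le> K" using K(2)[of y] mult_left_mono[OF _ K(1), of "vN n y" 1] by simp
  qed
  have S0: "norm (B (\<lambda>_. 0)) \<in> S"
    unfolding S_def by (auto intro!: exI[of _ "\<lambda>_. 0"] vW_const simp: vN_zero)
  define \<beta> where "\<beta> = Sup S"
  have \<beta>: "\<beta> \<ge> 0" using cSup_upper[OF S0 bdd] norm_ge_zero order_trans unfolding \<beta>_def by blast
  have le: "norm (B y) \<le> \<beta> * vN n y" if y: "vW n y" for y
  proof (cases "vN n y = 0")
    case True
    then show ?thesis using K(2)[OF y] by simp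
  next
    case False
    then have pos: "vN n y > 0" using vN_nonneg[OF y] by simp
    let ?c = "complex_of_real (1 / vN n y)"
    have "norm (B (\<lambda>x. ?c *s y x)) \<in> S"
      unfolding S_def using vW_N_cmul[OF y, of ?c] pos
      by (auto intro!: exI[of _ "\<lambda>x. ?c *s y x"] simp: norm_divide)
    then have "norm (B (\<lambda>x. ?c *s y x)) \<le> \<beta>" unfolding \<beta>_def by (rule cSup_upper[OF _ bdd])
    then show ?thesis
      using pos by (simp add: bounded_linear_W_D(2)[OF B y] norm_smult norm_divide field_simps)
  qed
  show thesis
  proof (cases "\<beta> = 0")
    case True
    then show thesis using that[OF \<beta> le vW_const[of n 0]] by (simp add: vN_zero)
  next
    case False
    then have "\<beta> / 2 < Sup S" using \<beta> by (simp add: \<beta>_def)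
    then obtain t where t: "t \<in> S" "\<beta> / 2 < t" using less_cSupD[of S] S0 by blast
    from t(1) obtain u where "vW n u" "vN n u \<le> 1" "t = norm (B u)" unfolding S_def by blast
    then show thesis using that[OF \<beta> le, of u] t(2) by simp
  qed
qed

text \<open>Sokal's proof of the uniform boundedness principle: the steps \<open>h j\<close>, of norm at most \<open>q ^ j\<close>,
  decrease so fast that the \<open>j\<close>-th one alone determines the size of \<open>B j\<close> at the limit.\<close>

lemma gliding_hump:
  fixes B :: "nat \<Rightarrow> (real \<Rightarrow> complex ^ 'm) \<Rightarrow> complex ^ 'm"
  assumes B: "\<And>j. bounded_linear_W a b n (B j)"
    and le: "\<And>j y. vW n y \<Longrightarrow> norm (B j y) \<le> \<beta> j * vN n y"
    and \<beta>: "\<And>j. \<beta> j \<ge> 0"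
    and u: "\<And>j. vW n (u j)" "\<And>j. vN n (u j) \<le> 1" "\<And>j. norm (B j (u j)) \<ge> \<beta> j / 2"
  defines "q \<equiv> 1 / (1 + 4 * (2 * (1 + (b - a))) ^ n)"
  shows "\<exists>x. vW n x \<and> (\<forall>j. norm (B j x) \<ge> q ^ j * \<beta> j / 4)"
proof -
  define C where "C = (2 * (1 + (b - a))) ^ n"
  have C: "C \<ge> 1" unfolding C_def using ab by (intro one_le_power) simp
  have qC: "q = 1 / (1 + 4 * C)" by (simp only: q_def C_def)
  \<comment> \<open>\<open>q\<close> is chosen to give \<open>C * (q / (1 - q)) = 1 / 4\<close>:
    step \<open>j\<close> contributes at least \<open>q ^ j * \<beta> j / 2\<close>, all later steps
    together at most half of that.\<close>
  have q: "0 < q" "q < 1" and Cq: "C * (q / (1 - q)) = 1 / 4"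
    using C unfolding qC by (auto simp: field_simps)
  define w where "w = (\<lambda>j. q ^ j)"
  \<comment> \<open>Of the two signs, one that keeps the step from being cancelled by the value of
    \<open>B j\<close> at the partial sum; \<open>norm_add_or_diff\<close> guarantees that one of
    them works.\<close>
  define sg where "sg = (\<lambda>j S. if norm (complex_of_real (q ^ j) *s B j (u j)) \<le> norm (B j S + complex_of_real (q ^ j) *s B j (u j))
      then complex_of_real (q ^ j) else - complex_of_real (q ^ j))"
  \<comment> \<open>The sign of a step depends on the sum of the preceding ones, so the recursion
    runs over partial sums.\<close>
  define S where "S = rec_nat (\<lambda>_. 0) (\<lambda>j s x. s x + sg j s *s u j x)"
  have S_0: "S 0 = (\<lambda>_. 0)" and S_Suc: "\<And>j. S (Suc j) = (\<lambda>x. S j x + sg j (S j) *s u j x)"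
    by (simp_all add: S_def)
  define h where "h = (\<lambda>j x. sg j (S j) *s u j x)"
  have norm_sg: "norm (sg j s) = q ^ j" for j s
    using q by (simp add: sg_def norm_power)
  have h: "vW n (h j)" "vN n (h j) \<le> q ^ j" for j
  proof -
    show "vW n (h j)" unfolding h_def by (rule vW_N_cmul(1)[OF u(1)])
    have "vN n (h j) \<le> norm (sg j (S j)) * vN n (u j)" unfolding h_def by (rule vW_N_cmul(2)[OF u(1)])
    also have "\<dots> \<le> q ^ j * 1" unfolding norm_sg by (rule mult_left_mono[OF u(2)]) (use q in simp)
    finally show "vN n (h j) \<le> q ^ j" by simp
  qed
  have S: "vW n (S j)" for j
  proof (induction j)
    case 0 show ?case unfolding S_0 by (rule vW_const)
  next
    case (Suc j) then show ?case unfolding S_Suc by (rule vW_N_add(1)[OF _ vW_N_cmul(1)[OF u(1)]])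
  qed
  have Ssum: "S k = (\<lambda>x. \<Sum>i<k. h i x)" for k
    by (induction k) (simp_all add: S_0 S_Suc h_def)
  have geo: "summable (\<lambda>j. q ^ (j + k))" "(\<Sum>j. q ^ (j + k)) = q ^ k / (1 - q)" for k
  proof -
    show "summable (\<lambda>j. q ^ (j + k))"
      by (rule summable_ignore_initial_segment[OF summable_geometric]) (use q in simp)
    have "(\<Sum>j. q ^ (j + k)) = (\<Sum>j. q ^ k * q ^ j)" by (simp add: power_add mult.commute)
    also have "\<dots> = q ^ k * (\<Sum>j. q ^ j)" by (rule suminf_mult[OF summable_geometric]) (use q in simp)
    also have "(\<Sum>j. q ^ j) = 1 / (1 - q)" by (rule suminf_geometric) (use q in simp)
    finally show "(\<Sum>j. q ^ (j + k)) = q ^ k / (1 - q)" by simp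
  qed
  have sh: "summable (\<lambda>j. vN n (h j))"
    by (rule summable_comparison_test[OF _ geo(1)[of 0]]) (use h(2) vN_nonneg[OF h(1)] in auto)
  obtain x where x: "vW n x" "\<And>k. vN n (\<lambda>t. x t - (\<Sum>i<k. h i t)) \<le> C * (\<Sum>i. vN n (h (i + k)))"
    using vW_complete[OF h(1) sh] by (auto simp: C_def)
  have tail: "vN n (\<lambda>t. x t - S k t) \<le> C * (q ^ k / (1 - q))" for k
  proof -
    have "(\<Sum>i. vN n (h (i + k))) \<le> (\<Sum>i. q ^ (i + k))"
      by (rule suminf_le[OF h(2) summable_ignore_initial_segment[OF sh] geo(1)])
    then show ?thesis
      using x(2)[of k] C unfolding geo(2) Ssum by (meson mult_left_mono order_trans zero_le_one)
  qed
  have "norm (B j x) \<ge> q ^ j * \<beta> j / 4" for j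
  proof -
    define v where "v = complex_of_real (q ^ j) *s B j (u j)"
    have "B j (S (Suc j)) = B j (S j) + sg j (S j) *s B j (u j)"
      unfolding S_Suc by (simp add: bounded_linear_W_D(1)[OF B S vW_N_cmul(1)[OF u(1)]] bounded_linear_W_D(2)[OF B u(1)])
    also have "\<dots> = (if norm v \<le> norm (B j (S j) + v) then B j (S j) + v else B j (S j) - v)"
      by (simp add: sg_def v_def vec_eq_iff)
    finally have "norm v \<le> norm (B j (S (Suc j)))"
      using norm_add_or_diff[of v "B j (S j)"] by auto
    moreover have "norm v = q ^ j * norm (B j (u j))" using q by (simp add: v_def norm_smult norm_power)
    moreover have "q ^ j * (\<beta> j / 2) \<le> q ^ j * norm (B j (u j))"
      by (rule mult_left_mono[OF u(3)]) (use q in simp)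
    ultimately have big: "q ^ j * (\<beta> j / 2) \<le> norm (B j (S (Suc j)))" by linarith
    have "norm (B j (\<lambda>t. x t - S (Suc j) t)) \<le> \<beta> j * vN n (\<lambda>t. x t - S (Suc j) t)"
      by (rule le[OF vW_N_diff(1)[OF x(1) S]])
    also have "\<dots> \<le> \<beta> j * (C * (q ^ Suc j / (1 - q)))" by (rule mult_left_mono[OF tail \<beta>])
    also have "\<dots> = \<beta> j * q ^ j * (C * (q / (1 - q)))" by simp
    also have "\<dots> = q ^ j * \<beta> j / 4" unfolding Cq by simp
    finally have small: "norm (B j x - B j (S (Suc j))) \<le> q ^ j * \<beta> j / 4"
      by (simp add: bounded_linear_W_diff[OF B x(1) S])
    have "norm (B j (S (Suc j))) \<le> norm (B j x) + norm (B j x - B j (S (Suc j)))"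
      by (metis norm_minus_commute norm_triangle_sub)
    with big small show ?thesis by simp
  qed
  with x(1) show ?thesis by blast
qed

lemma uniform_boundedness:
  fixes B :: "nat \<Rightarrow> (real \<Rightarrow> complex ^ 'm) \<Rightarrow> complex ^ 'm"
  assumes B: "\<And>j. bounded_linear_W a b n (B j)"
    and pt: "\<And>y. vW n y \<Longrightarrow> Bseq (\<lambda>j. B j y)"
  shows "\<exists>K. \<forall>j y. vW n y \<longrightarrow> norm (B j y) \<le> K * vN n y"
proof (rule ccontr)
  assume unb: "\<nexists>K. \<forall>j y. vW n y \<longrightarrow> norm (B j y) \<le> K * vN n y"
  have "\<forall>j. \<exists>\<beta> u. \<beta> \<ge> 0 \<and> (\<forall>y. vW n y \<longrightarrow> norm (B j y) \<le> \<beta> * vN n y) \<and> vW n u \<and> vN n u \<le> 1 \<and> norm (B j u) \<ge> \<beta> / 2"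
  proof
    fix j
    show "\<exists>\<beta> u. \<beta> \<ge> 0 \<and> (\<forall>y. vW n y \<longrightarrow> norm (B j y) \<le> \<beta> * vN n y) \<and> vW n u \<and> vN n u \<le> 1 \<and> norm (B j u) \<ge> \<beta> / 2"
      by (rule norming_element[OF B[of j]]) blast
  qed
  from choice[OF this] obtain \<beta> where "\<forall>j. \<exists>u. \<beta> j \<ge> 0 \<and> (\<forall>y. vW n y \<longrightarrow> norm (B j y) \<le> \<beta> j * vN n y) \<and> vW n u \<and> vN n u \<le> 1 \<and> norm (B j u) \<ge> \<beta> j / 2" by blast
  from choice[OF this] obtain u where \<beta>: "\<And>j. \<beta> j \<ge> 0" "\<And>j y. vW n y \<Longrightarrow> norm (B j y) \<le> \<beta> j * vN n y"
    and u: "\<And>j. vW n (u j)" "\<And>j. vN n (u j) \<le> 1" "\<And>j. norm (B j (u j)) \<ge> \<beta> j / 2" by blast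
  define q where "q = 1 / (1 + 4 * (2 * (1 + (b - a))) ^ n)"
  have q: "q > 0" unfolding q_def using ab by (intro divide_pos_pos add_pos_nonneg) auto
  \<comment> \<open>Unboundedness supplies norms that outgrow the decay of the steps, so that the
    lower bound \<open>q ^ j * \<beta> (\<sigma> j) / 4\<close> is at least \<open>j\<close>. The
    selection \<sigma> need not be monotone.\<close>
  have "\<exists>k. \<beta> k \<ge> 4 * real j / q ^ j" for j
  proof (rule ccontr)
    assume "\<nexists>k. \<beta> k \<ge> 4 * real j / q ^ j"
    then have "norm (B k y) \<le> (4 * real j / q ^ j) * vN n y" if "vW n y" for k y
      using order_trans[OF \<beta>(2)[OF that] mult_right_mono[OF _ vN_nonneg[OF that]]] by (meson linear)
    with unb show False by blast
  qed
  then obtain \<sigma> where \<sigma>: "\<And>j. \<beta> (\<sigma> j) \<ge> 4 * real j / q ^ j" by metis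
  obtain x where x: "vW n x" "\<And>j. norm (B (\<sigma> j) x) \<ge> q ^ j * \<beta> (\<sigma> j) / 4"
    using gliding_hump[of n "\<lambda>j. B (\<sigma> j)" "\<lambda>j. \<beta> (\<sigma> j)" "\<lambda>j. u (\<sigma> j)", OF B \<beta>(2) \<beta>(1) u]
    unfolding q_def by blast
  obtain K where K: "\<And>j. norm (B j x) \<le> K" using pt[OF x(1)] unfolding Bseq_def by blast
  have "real j \<le> K" for j
  proof -
    have "real j = q ^ j * (4 * real j / q ^ j) / 4" using q by simp
    also have "\<dots> \<le> q ^ j * \<beta> (\<sigma> j) / 4"
      by (intro divide_right_mono mult_left_mono \<sigma>) (use q in auto)
    also have "\<dots> \<le> K" using x(2)[of j] K[of "\<sigma> j"] by linarith
    finally show ?thesis .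
  qed
  then show False using reals_Archimedean2[of K] by (meson not_less)
qed

text \<open>Convergence at 0 controls only small \<epsilon>, hence the eventual bound. If every
  bound \<open>real k\<close> failed arbitrarily close to 0, there would be a sequence
  \<open>e\<close> tending to 0 along which \<open>B\<close> converges pointwise and is thus bounded
  pointwise, but not uniformly.\<close>

lemma eventually_uniformly_bounded:
  fixes B :: "real \<Rightarrow> (real \<Rightarrow> complex ^ 'm) \<Rightarrow> complex ^ 'm"
  assumes "\<epsilon>0 > 0" and B: "\<And>\<epsilon>. \<epsilon> \<in> {0..<\<epsilon>0} \<Longrightarrow> bounded_linear_W a b n (B \<epsilon>)"
    and conv: "\<And>y. vW n y \<Longrightarrow> ((\<lambda>\<epsilon>. B \<epsilon> y) \<longlongrightarrow> B 0 y) (at_right 0)"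
  shows "\<exists>K\<ge>0. \<forall>\<^sub>F \<epsilon> in at_right 0. \<forall>y. vW n y \<longrightarrow> norm (B \<epsilon> y) \<le> K * vN n y"
proof (rule ccontr)
  assume neg: "\<not> ?thesis"
  have "\<exists>\<epsilon>. 0 < \<epsilon> \<and> \<epsilon> < \<epsilon>0 \<and> \<epsilon> < inverse (real (Suc k)) \<and> \<not> (\<forall>y. vW n y \<longrightarrow> norm (B \<epsilon> y) \<le> real k * vN n y)" for k
  proof (rule ccontr)
    assume *: "\<not> ?thesis"
    have "\<forall>\<^sub>F \<epsilon> in at_right 0. \<forall>y. vW n y \<longrightarrow> norm (B \<epsilon> y) \<le> real k * vN n y"
      unfolding eventually_at_right_field
      by (rule exI[of _ "min \<epsilon>0 (inverse (real (Suc k)))"]) (use * assms(1) in auto)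
    then show False using neg of_nat_0_le_iff[of k] by blast
  qed
  then have "\<forall>k. \<exists>\<epsilon>. 0 < \<epsilon> \<and> \<epsilon> < \<epsilon>0 \<and> \<epsilon> < inverse (real (Suc k)) \<and> \<not> (\<forall>y. vW n y \<longrightarrow> norm (B \<epsilon> y) \<le> real k * vN n y)"
    by blast
  from choice[OF this] obtain e where e: "\<And>k. 0 < e k" "\<And>k. e k < \<epsilon>0" "\<And>k. e k < inverse (real (Suc k))"
    "\<And>k. \<not> (\<forall>y. vW n y \<longrightarrow> norm (B (e k) y) \<le> real k * vN n y)" by blast
  have "e \<longlonglongrightarrow> 0"
    by (rule tendsto_sandwich[OF _ _ tendsto_const LIMSEQ_inverse_real_of_nat])
      (use e(1,3) in \<open>auto simp: less_imp_le\<close>)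
  then have lim: "filterlim e (at_right 0) sequentially"
    using e(1) by (auto simp: filterlim_at less_imp_neq[symmetric])
  have "\<exists>K. \<forall>j y. vW n y \<longrightarrow> norm (B (e j) y) \<le> K * vN n y"
  proof (rule uniform_boundedness)
    show "bounded_linear_W a b n (B (e j))" for j using e(1,2) by (intro B) (auto simp: less_imp_le)
    fix y :: "real \<Rightarrow> complex ^ 'm" assume "vW n y"
    from filterlim_compose[OF conv[OF this] lim] show "Bseq (\<lambda>j. B (e j) y)"
      by (intro convergent_imp_Bseq) (auto simp: convergent_def)
  qed
  then obtain K where K: "\<And>j y. vW n y \<Longrightarrow> norm (B (e j) y) \<le> K * vN n y" by blast
  obtain k where "K < real k" using reals_Archimedean2 by blast
  then have "norm (B (e k) y) \<le> real k * vN n y" if "vW n y" for y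
    by (intro order_trans[OF K[OF that]] mult_right_mono vN_nonneg[OF that]) simp
  with e(4) show False by blast
qed

section \<open>The estimate uniform in \<epsilon>\<close>

lemma mW_diff: "mW n A \<Longrightarrow> mW n A' \<Longrightarrow> mW n (\<lambda>x. A x - A' x)"
  unfolding mW_inf_def using W_N_diff by simp

lemma uniform_a_priori_estimate:
  fixes A :: "real \<Rightarrow> real \<Rightarrow> complex ^ 'm ^ 'm" and B :: "real \<Rightarrow> (real \<Rightarrow> complex ^ 'm) \<Rightarrow> complex ^ 'm"
  assumes eps0: "\<epsilon>0 > 0"
    and A_W: "\<And>\<epsilon>. \<epsilon> \<in> {0..<\<epsilon>0} \<Longrightarrow> mW k (A \<epsilon>)"
    and B_bl: "\<And>\<epsilon>. \<epsilon> \<in> {0..<\<epsilon>0} \<Longrightarrow> bounded_linear_W a b (Suc k) (B \<epsilon>)"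
    and uniq0: "\<And>y. vW (Suc k) y \<Longrightarrow> solves_ode a b (A 0) (\<lambda>_. 0) y \<Longrightarrow> B 0 y = 0
                 \<Longrightarrow> \<forall>x\<in>{a..b}. y x = 0"
    and A_conv: "((\<lambda>\<epsilon>. mN k (\<lambda>x. A \<epsilon> x - A 0 x)) \<longlongrightarrow> 0) (at_right 0)"
    and B_conv: "\<And>y. vW (Suc k) y \<Longrightarrow> ((\<lambda>\<epsilon>. B \<epsilon> y) \<longlongrightarrow> B 0 y) (at_right 0)"
  shows "\<exists>K\<ge>0. \<forall>\<^sub>F \<epsilon> in at_right 0. \<forall>f y. vW k f \<longrightarrow> vW (Suc k) y \<longrightarrow> solves_ode a b (A \<epsilon>) f y \<longrightarrow>
           vN (Suc k) y \<le> K * (vN k f + norm (B \<epsilon> y))"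
proof -
  have A0: "mW k (A 0)" and B0: "bounded_linear_W a b (Suc k) (B 0)" using A_W B_bl eps0 by auto
  obtain C where C: "C \<ge> 0" "\<And>f y. vW k f \<Longrightarrow> vW (Suc k) y \<Longrightarrow> solves_ode a b (A 0) f y \<Longrightarrow>
      vN (Suc k) y \<le> C * (norm (y a) + vN k f)"
    using solves_ode_norm_bound[OF A0] by blast
  obtain KB where KB: "KB \<ge> 0"
    "\<forall>\<^sub>F \<epsilon> in at_right 0. \<forall>y. vW (Suc k) y \<longrightarrow> norm (B \<epsilon> y) \<le> KB * vN (Suc k) y"
    using eventually_uniformly_bounded[OF eps0 B_bl B_conv] by blast
  define Y where "Y = fundamental k (A 0)"
  note Y = fundamental[OF A0, folded Y_def]
  note linY = linear_B_fundamental[OF A0, folded Y_def]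
  \<comment> \<open>Uniqueness for the limit problem enters here: an injective linear map on a
    finite-dimensional space is bounded below.\<close>
  obtain \<delta> where \<delta>: "\<delta> > 0" "\<And>\<eta>. norm (B 0 (Y \<eta>)) \<ge> \<delta> * norm \<eta>"
    using linear_inj_bounded_below_pos[OF linY[OF B0] inj_B_fundamental[OF A0 B0 uniq0, folded Y_def]] by blast
  \<comment> \<open>Strong convergence on the finitely many basis solutions becomes convergence in
    norm on all homogeneous solutions.\<close>
  define \<beta> where "\<beta> = (\<lambda>\<epsilon>. \<Sum>e\<in>Basis. norm (B \<epsilon> (Y e) - B 0 (Y e)))"
  have \<beta>: "norm (B \<epsilon> (Y \<eta>) - B 0 (Y \<eta>)) \<le> \<beta> \<epsilon> * norm \<eta>" if \<epsilon>: "\<epsilon> \<in> {0..<\<epsilon>0}" for \<epsilon> \<eta>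
  proof -
    define D where "D = (\<lambda>\<eta>. B \<epsilon> (Y \<eta>) - B 0 (Y \<eta>))"
    have D: "linear D" unfolding D_def by (intro linear_compose_sub linY B_bl B0 \<epsilon>)
    have "D \<eta> = D (\<Sum>e\<in>Basis. (\<eta> \<bullet> e) *\<^sub>R e)" by (simp add: euclidean_representation)
    also have "\<dots> = (\<Sum>e\<in>Basis. (\<eta> \<bullet> e) *\<^sub>R D e)" by (simp add: linear_sum[OF D] linear_scale[OF D])
    also have "norm \<dots> \<le> (\<Sum>e\<in>Basis. norm \<eta> * norm (D e))"
      by (rule sum_norm_le) (simp add: Basis_le_norm mult_right_mono)
    finally show ?thesis by (simp add: D_def \<beta>_def sum_distrib_left mult.commute)
  qed
  have \<beta>_lim: "(\<beta> \<longlongrightarrow> 0) (at_right 0)"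
    unfolding \<beta>_def
  proof (rule tendsto_null_sum)
    fix e :: "complex ^ 'm"
    show "((\<lambda>\<epsilon>. norm (B \<epsilon> (Y e) - B 0 (Y e))) \<longlongrightarrow> 0) (at_right 0)"
      using tendsto_norm[OF LIM_zero[OF B_conv[OF Y(1)]]] by simp
  qed
  define \<alpha> where "\<alpha> = (\<lambda>\<epsilon>. mN k (\<lambda>x. A \<epsilon> x - A 0 x))"
  \<comment> \<open>These are the coefficients in \<open>M \<le> P * Z + Q * G\<close>, obtained by
    inserting the bound for \<open>norm \<eta>\<close> into
    \<open>M \<le> Z + vN (Suc k) (Y \<eta>)\<close>. The bound for \<open>Z\<close> contains a
    multiple of \<open>M\<close>; the threshold 1/2 lets it be absorbed.\<close>
  define P Q where "P = 1 + C * (2 / \<delta>) * KB" and "Q = C * (2 / \<delta>)"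
  have P: "P \<ge> 1" and Q: "Q \<ge> 0" using C(1) KB(1) \<delta>(1) by (auto simp: P_def Q_def)
  have "((\<lambda>\<epsilon>. P * (C * 2 ^ k * \<alpha> \<epsilon>)) \<longlongrightarrow> P * (C * 2 ^ k * 0)) (at_right 0)"
    unfolding \<alpha>_def by (intro tendsto_intros A_conv)
  then have small: "\<forall>\<^sub>F \<epsilon> in at_right 0. P * (C * 2 ^ k * \<alpha> \<epsilon>) < 1 / 2"
    by (rule order_tendstoD) simp
  have small': "\<forall>\<^sub>F \<epsilon> in at_right 0. \<beta> \<epsilon> < \<delta> / 2"
    by (rule order_tendstoD[OF \<beta>_lim]) (use \<delta> in simp)
  have rng: "\<forall>\<^sub>F \<epsilon> in at_right 0. \<epsilon> \<in> {0..<\<epsilon>0}"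
    unfolding eventually_at_right_field by (rule exI[of _ \<epsilon>0]) (use eps0 in auto)
  define K where "K = 2 * (P * C + Q)"
  have "\<forall>\<^sub>F \<epsilon> in at_right 0. \<forall>f y. vW k f \<longrightarrow> vW (Suc k) y \<longrightarrow> solves_ode a b (A \<epsilon>) f y \<longrightarrow>
           vN (Suc k) y \<le> K * (vN k f + norm (B \<epsilon> y))"
    using KB(2) small small' rng
  proof eventually_elim
    case (elim \<epsilon>)
    show ?case
    proof (intro allI impI)
      fix f y :: "real \<Rightarrow> complex ^ 'm"
      assume f: "vW k f" and y: "vW (Suc k) y" and sol: "solves_ode a b (A \<epsilon>) f y"
      define \<eta> where "\<eta> = y a"
      define F G Z M where "F = vN k f" and "G = norm (B \<epsilon> y)"
        and "Z = vN (Suc k) (\<lambda>x. y x - Y \<eta> x)" and "M = vN (Suc k) y"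
      have B\<epsilon>: "bounded_linear_W a b (Suc k) (B \<epsilon>)" and A\<epsilon>: "mW k (A \<epsilon>)" using elim(4) A_W B_bl by auto
      have dA: "mW k (\<lambda>x. A \<epsilon> x - A 0 x)" by (rule mW_diff[OF A\<epsilon> A0])
      have yk: "vW k y" by (rule vW_mono[OF _ y]) simp
      have M: "M \<ge> 0" unfolding M_def by (rule vN_nonneg[OF y])
      have z: "vW (Suc k) (\<lambda>x. y x - Y \<eta> x)" by (rule vW_N_diff(1)[OF y Y(1)])
      let ?g = "\<lambda>x. f x - (A \<epsilon> x - A 0 x) *v y x"
      have g: "vW k ?g" by (rule vW_residual[OF dA f yk])
      have "solves_ode a b (A 0) ?g (\<lambda>x. y x - Y \<eta> x)"
        using solves_ode_diff[OF solves_ode_change_coeff[OF sol, of "A 0"] Y(2)[of \<eta>]] by simp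
      \<comment> \<open>\<open>y\<close> and \<open>Y \<eta>\<close> agree at \<open>a\<close>, so
        the estimate retains only the residual and no initial value.\<close>
      from C(2)[OF g z this] have "Z \<le> C * vN k ?g"
        by (simp add: Z_def \<eta>_def Y(3))
      also have "\<dots> \<le> C * (F + 2 ^ k * \<alpha> \<epsilon> * M)"
      proof (rule mult_left_mono[OF _ C(1)])
        have "vN k ?g \<le> F + vN k (\<lambda>x. (A \<epsilon> x - A 0 x) *v y x)"
          unfolding F_def by (rule vW_N_diff(2)[OF f vW_N_matvec(1)[OF dA yk]])
        also have "vN k (\<lambda>x. (A \<epsilon> x - A 0 x) *v y x) \<le> 2 ^ k * \<alpha> \<epsilon> * vN k y"
          unfolding \<alpha>_def by (rule vW_N_matvec(2)[OF dA yk])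
        also have "\<dots> \<le> 2 ^ k * \<alpha> \<epsilon> * M"
          unfolding M_def \<alpha>_def by (intro mult_left_mono vN_mono y) (simp_all add: mN_nonneg[OF dA])
        finally show "vN k ?g \<le> F + 2 ^ k * \<alpha> \<epsilon> * M" by simp
      qed
      finally have Z: "Z \<le> C * F + C * 2 ^ k * \<alpha> \<epsilon> * M" by (simp add: algebra_simps)
      have "norm (B \<epsilon> (\<lambda>x. y x - Y \<eta> x)) \<le> KB * Z" using elim(1) z by (simp add: Z_def)
      then have Bz: "norm (B \<epsilon> y - B \<epsilon> (Y \<eta>)) \<le> KB * Z" by (simp add: bounded_linear_W_diff[OF B\<epsilon> y Y(1)])
      \<comment> \<open>Passing from \<open>B 0\<close> to \<open>B \<epsilon>\<close> on
        \<open>Y \<eta>\<close> costs half of the left side; passing from \<open>Y \<eta>\<close> to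
        \<open>y\<close> costs \<open>KB * Z\<close>.\<close>
      have "\<delta> * norm \<eta> \<le> norm (B 0 (Y \<eta>))" by (rule \<delta>(2))
      also have "\<dots> \<le> norm (B \<epsilon> (Y \<eta>)) + norm (B \<epsilon> (Y \<eta>) - B 0 (Y \<eta>))"
        by (metis norm_minus_commute norm_triangle_sub)
      also have "norm (B \<epsilon> (Y \<eta>)) \<le> G + norm (B \<epsilon> y - B \<epsilon> (Y \<eta>))"
        unfolding G_def by (metis norm_minus_commute norm_triangle_sub)
      also have "norm (B \<epsilon> (Y \<eta>) - B 0 (Y \<eta>)) \<le> \<delta> / 2 * norm \<eta>"
        using \<beta>[OF elim(4), of \<eta>] mult_right_mono[OF less_imp_le[OF elim(3)] norm_ge_zero[of \<eta>]] by linarith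
      finally have "\<delta> / 2 * norm \<eta> \<le> G + KB * Z" using Bz by linarith
      then have "norm \<eta> \<le> 2 / \<delta> * (G + KB * Z)" using \<delta>(1) by (simp add: field_simps)
      then have \<eta>: "C * norm \<eta> \<le> C * (2 / \<delta> * (G + KB * Z))" by (rule mult_left_mono[OF _ C(1)])
      have "vN (Suc k) (Y \<eta>) \<le> C * (norm (Y \<eta> a) + vN k (\<lambda>_. 0 :: complex ^ 'm))"
        by (rule C(2)[OF vW_const Y(1,2)])
      then have w: "vN (Suc k) (Y \<eta>) \<le> C * norm \<eta>" by (simp add: Y(3) vN_zero)
      have "M \<le> Z + vN (Suc k) (Y \<eta>)"
        using vW_N_add(2)[OF z Y(1), of \<eta>] by (simp add: M_def Z_def)
      also have "\<dots> \<le> Z + C * (2 / \<delta> * (G + KB * Z))" using w \<eta> by linarith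
      also have "\<dots> = P * Z + Q * G" by (simp add: P_def Q_def algebra_simps add_divide_distrib)
      also have "P * Z \<le> P * (C * F + C * 2 ^ k * \<alpha> \<epsilon> * M)" by (rule mult_left_mono[OF Z]) (use P in simp)
      also have "\<dots> = P * C * F + P * (C * 2 ^ k * \<alpha> \<epsilon>) * M" by (simp add: algebra_simps)
      also have "P * (C * 2 ^ k * \<alpha> \<epsilon>) * M \<le> 1 / 2 * M"
        by (rule mult_right_mono[OF less_imp_le[OF elim(2)] M])
      finally have "M \<le> 2 * (P * C * F + Q * G)" by simp
      also have "\<dots> \<le> K * (F + G)"
      proof -
        have "0 \<le> P * C * G" "0 \<le> Q * F"
          using P C(1) Q vN_nonneg[OF f] by (auto simp: F_def G_def)
        then show ?thesis by (simp add: K_def algebra_simps)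
      qed
      finally show "vN (Suc k) y \<le> K * (vN k f + norm (B \<epsilon> y))" by (simp add: M_def F_def G_def)
    qed
  qed
  moreover have "K \<ge> 0" using P C(1) Q by (simp add: K_def)
  ultimately show ?thesis by blast
qed

text \<open>The estimate with zero data gives uniqueness, uniqueness gives existence by the
  dimension count, and the estimate itself bounds the inverse.\<close>

lemma LB_invertibleI:
  assumes A: "mW k A" and B: "bounded_linear_W a b (Suc k) B"
    and K: "\<And>f y. vW k f \<Longrightarrow> vW (Suc k) y \<Longrightarrow> solves_ode a b A f y \<Longrightarrow>
           vN (Suc k) y \<le> K * (vN k f + norm (B y))"
  shows "LB_invertible a b (Suc k) A B"
proof -
  have uniq: "\<forall>x\<in>{a..b}. y x = 0" if "vW (Suc k) y" "solves_ode a b A (\<lambda>_. 0) y" "B y = 0" for y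
  proof -
    have "vN (Suc k) y \<le> 0" using K[OF vW_const that(1,2)] that(3) by (simp add: vN_zero)
    then show ?thesis using vN_Suc_eq_0[OF that(1)] by blast
  qed
  have "\<exists>y. vW (Suc k) y \<and> solves_ode a b A f y \<and> B y = c" if "vW k f" for f c
    by (rule bvp_solution_exists[OF A B uniq that])
  then show ?thesis unfolding LB_invertible_def diff_Suc_1 using uniq K by blast
qed

end

section \<open>Invertibility and convergence of the solutions\<close>

theorem theorem3:
  fixes a b \<epsilon>0 :: real and n :: nat
    and A :: "real \<Rightarrow> real \<Rightarrow> complex ^ 'm ^ 'm"
    and f :: "real \<Rightarrow> real \<Rightarrow> complex ^ 'm"
    and c :: "real \<Rightarrow> complex ^ 'm"
    and B :: "real \<Rightarrow> (real \<Rightarrow> complex ^ 'm) \<Rightarrow> complex ^ 'm"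
  assumes ab: "a < b" and n: "n \<ge> 1" and eps0: "\<epsilon>0 > 0"
    and A_W: "\<And>\<epsilon>. \<epsilon> \<in> {0..<\<epsilon>0} \<Longrightarrow> mW_inf a b (n - 1) (A \<epsilon>)"
    and f_W: "\<And>\<epsilon>. \<epsilon> \<in> {0..<\<epsilon>0} \<Longrightarrow> vW_inf a b (n - 1) (f \<epsilon>)"
    and B_bl: "\<And>\<epsilon>. \<epsilon> \<in> {0..<\<epsilon>0} \<Longrightarrow> bounded_linear_W a b n (B \<epsilon>)"
    and uniq0: "\<And>y. vW_inf a b n y \<Longrightarrow> solves_ode a b (A 0) (\<lambda>_. 0) y \<Longrightarrow> B 0 y = 0
                 \<Longrightarrow> \<forall>x\<in>{a..b}. y x = 0"
    and A_conv: "((\<lambda>\<epsilon>. mW_norm a b (n - 1) (\<lambda>x. A \<epsilon> x - A 0 x)) \<longlongrightarrow> 0) (at_right 0)"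
    and B_conv: "\<And>y. vW_inf a b n y \<Longrightarrow> ((\<lambda>\<epsilon>. B \<epsilon> y) \<longlongrightarrow> B 0 y) (at_right 0)"
  shows "(\<forall>\<^sub>F \<epsilon> in at_right 0. LB_invertible a b n (A \<epsilon>) (B \<epsilon>))
    \<and> ((((\<lambda>\<epsilon>. vW_norm a b (n - 1) (\<lambda>x. f \<epsilon> x - f 0 x)) \<longlongrightarrow> 0) (at_right 0)
         \<and> (c \<longlongrightarrow> c 0) (at_right 0))
       \<longrightarrow> (\<exists>y. vW_inf a b n (y 0) \<and> solves_ode a b (A 0) (f 0) (y 0) \<and> B 0 (y 0) = c 0
                \<and> (\<forall>\<^sub>F \<epsilon> in at_right 0. vW_inf a b n (y \<epsilon>) \<and> solves_ode a b (A \<epsilon>) (f \<epsilon>) (y \<epsilon>)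
                                        \<and> B \<epsilon> (y \<epsilon>) = c \<epsilon>))
         \<and> (\<forall>y. vW_inf a b n (y 0) \<and> solves_ode a b (A 0) (f 0) (y 0) \<and> B 0 (y 0) = c 0
                \<and> (\<forall>\<^sub>F \<epsilon> in at_right 0. vW_inf a b n (y \<epsilon>) \<and> solves_ode a b (A \<epsilon>) (f \<epsilon>) (y \<epsilon>)
                                        \<and> B \<epsilon> (y \<epsilon>) = c \<epsilon>)
              \<longrightarrow> ((\<lambda>\<epsilon>. vW_norm a b n (\<lambda>x. y \<epsilon> x - y 0 x)) \<longlongrightarrow> 0) (at_right 0)))"
proof -
  interpret compact_interval a b by unfold_locales (rule ab)
  obtain k where nk: "n = Suc k" using n by (cases n) auto
  have AW: "\<And>\<epsilon>. \<epsilon> \<in> {0..<\<epsilon>0} \<Longrightarrow> mW k (A \<epsilon>)" and fW: "\<And>\<epsilon>. \<epsilon> \<in> {0..<\<epsilon>0} \<Longrightarrow> vW k (f \<epsilon>)"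
    and Bb: "\<And>\<epsilon>. \<epsilon> \<in> {0..<\<epsilon>0} \<Longrightarrow> bounded_linear_W a b (Suc k) (B \<epsilon>)"
    and Ac: "((\<lambda>\<epsilon>. mN k (\<lambda>x. A \<epsilon> x - A 0 x)) \<longlongrightarrow> 0) (at_right 0)"
    and Bc: "\<And>y. vW (Suc k) y \<Longrightarrow> ((\<lambda>\<epsilon>. B \<epsilon> y) \<longlongrightarrow> B 0 y) (at_right 0)"
    and u0: "\<And>y. vW (Suc k) y \<Longrightarrow> solves_ode a b (A 0) (\<lambda>_. 0) y \<Longrightarrow> B 0 y = 0 \<Longrightarrow> \<forall>x\<in>{a..b}. y x = 0"
    using A_W f_W B_bl A_conv B_conv uniq0 unfolding nk diff_Suc_1 by blast+
  have A0: "mW k (A 0)" and f0: "vW k (f 0)" and B0: "bounded_linear_W a b (Suc k) (B 0)"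
    using AW fW Bb eps0 by auto
  obtain K where K: "K \<ge> 0" "\<forall>\<^sub>F \<epsilon> in at_right 0. \<forall>f y. vW k f \<longrightarrow> vW (Suc k) y \<longrightarrow> solves_ode a b (A \<epsilon>) f y \<longrightarrow>
           vN (Suc k) y \<le> K * (vN k f + norm (B \<epsilon> y))"
    using uniform_a_priori_estimate[OF eps0 AW Bb u0 Ac Bc] by blast
  have rng: "\<forall>\<^sub>F \<epsilon> in at_right 0. \<epsilon> \<in> {0<..<\<epsilon>0}"
    unfolding eventually_at_right_field by (rule exI[of _ \<epsilon>0]) (use eps0 in auto)
  have inv: "\<forall>\<^sub>F \<epsilon> in at_right 0. LB_invertible a b (Suc k) (A \<epsilon>) (B \<epsilon>)"
    using K(2) rng
  proof eventually_elim
    case (elim \<epsilon>)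
    then show ?case by (intro LB_invertibleI[of k _ _ K] AW Bb) auto
  qed
  have ex: "\<exists>y. vW (Suc k) (y 0) \<and> solves_ode a b (A 0) (f 0) (y 0) \<and> B 0 (y 0) = c 0
                \<and> (\<forall>\<^sub>F \<epsilon> in at_right 0. vW (Suc k) (y \<epsilon>) \<and> solves_ode a b (A \<epsilon>) (f \<epsilon>) (y \<epsilon>)
                                        \<and> B \<epsilon> (y \<epsilon>) = c \<epsilon>)"
  proof -
    define sol where "sol = (\<lambda>\<epsilon> y. vW (Suc k) y \<and> solves_ode a b (A \<epsilon>) (f \<epsilon>) y \<and> B \<epsilon> y = c \<epsilon>)"
    \<comment> \<open>One choice for all \<epsilon>; it is a solution wherever one exists, which is
      known at 0 and for all small positive \<epsilon>.\<close>
    define y where "y = (\<lambda>\<epsilon>. SOME y. sol \<epsilon> y)"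
    have "\<exists>y. sol 0 y" unfolding sol_def by (rule bvp_solution_exists[OF A0 B0 u0 f0])
    then have "sol 0 (y 0)" unfolding y_def by (rule someI_ex)
    moreover have "\<forall>\<^sub>F \<epsilon> in at_right 0. sol \<epsilon> (y \<epsilon>)"
      using inv rng
    proof eventually_elim
      case (elim \<epsilon>)
      then have "vW k (f \<epsilon>)" by (intro fW) auto
      then have "\<exists>y. sol \<epsilon> y" using elim(1) unfolding LB_invertible_def sol_def diff_Suc_1 by blast
      then show ?case unfolding y_def by (rule someI_ex)
    qed
    ultimately show ?thesis unfolding sol_def by blast
  qed
  have conv: "((\<lambda>\<epsilon>. vN (Suc k) (\<lambda>x. y \<epsilon> x - y 0 x)) \<longlongrightarrow> 0) (at_right 0)"
    if fc: "((\<lambda>\<epsilon>. vN k (\<lambda>x. f \<epsilon> x - f 0 x)) \<longlongrightarrow> 0) (at_right 0)" and cc: "(c \<longlongrightarrow> c 0) (at_right 0)"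
      and y0: "vW (Suc k) (y 0)" "solves_ode a b (A 0) (f 0) (y 0)" "B 0 (y 0) = c 0"
      and ye: "\<forall>\<^sub>F \<epsilon> in at_right 0. vW (Suc k) (y \<epsilon>) \<and> solves_ode a b (A \<epsilon>) (f \<epsilon>) (y \<epsilon>) \<and> B \<epsilon> (y \<epsilon>) = c \<epsilon>"
    for y
  proof (rule Lim_null_comparison)
    \<comment> \<open>The difference \<open>y \<epsilon> - y 0\<close> solves the \<epsilon>-problem
      with a residual formed from \<open>f \<epsilon> - f 0\<close> and
      \<open>(A \<epsilon> - A 0) y 0\<close> and with boundary value
      \<open>c \<epsilon> - B \<epsilon> (y 0)\<close>. Here \<open>B \<epsilon>\<close> acts on the
      fixed function \<open>y 0\<close>, so strong convergence is enough.\<close>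
    define bound where "bound = (\<lambda>\<epsilon>. K * (vN k (\<lambda>x. f \<epsilon> x - f 0 x)
        + 2 ^ k * mN k (\<lambda>x. A \<epsilon> x - A 0 x) * vN k (y 0) + norm (c \<epsilon> - B \<epsilon> (y 0))))"
    have "(bound \<longlongrightarrow> K * (0 + 2 ^ k * 0 * vN k (y 0) + norm (c 0 - B 0 (y 0)))) (at_right 0)"
      unfolding bound_def by (intro tendsto_intros fc Ac cc Bc y0)
    then show "(bound \<longlongrightarrow> 0) (at_right 0)" by (simp add: y0(3))
    show "\<forall>\<^sub>F \<epsilon> in at_right 0. norm (vN (Suc k) (\<lambda>x. y \<epsilon> x - y 0 x)) \<le> bound \<epsilon>"
      using ye K(2) rng
    proof eventually_elim
      case (elim \<epsilon>)
      then have \<epsilon>: "\<epsilon> \<in> {0..<\<epsilon>0}" and y: "vW (Suc k) (y \<epsilon>)" "solves_ode a b (A \<epsilon>) (f \<epsilon>) (y \<epsilon>)" "B \<epsilon> (y \<epsilon>) = c \<epsilon>"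
        by auto
      have dA: "mW k (\<lambda>x. A \<epsilon> x - A 0 x)" and df: "vW k (\<lambda>x. f \<epsilon> x - f 0 x)"
        by (rule mW_diff[OF AW[OF \<epsilon>] A0], rule vW_N_diff(1)[OF fW[OF \<epsilon>] f0])
      have y0k: "vW k (y 0)" by (rule vW_mono[OF _ y0(1)]) simp
      let ?g = "\<lambda>x. f \<epsilon> x - f 0 x - (A \<epsilon> x - A 0 x) *v y 0 x"
      have "solves_ode a b (A \<epsilon>) (\<lambda>x. f \<epsilon> x - (f 0 x - (A 0 x - A \<epsilon> x) *v y 0 x)) (\<lambda>x. y \<epsilon> x - y 0 x)"
        by (rule solves_ode_diff[OF y(2) solves_ode_change_coeff[OF y0(2)]])
      moreover have "(\<lambda>x. f \<epsilon> x - (f 0 x - (A 0 x - A \<epsilon> x) *v y 0 x)) = ?g"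
        by (simp add: fun_eq_iff matrix_vector_mult_diff_rdistrib)
      ultimately have sol: "solves_ode a b (A \<epsilon>) ?g (\<lambda>x. y \<epsilon> x - y 0 x)" by simp
      have d: "vW (Suc k) (\<lambda>x. y \<epsilon> x - y 0 x)" by (rule vW_N_diff(1)[OF y(1) y0(1)])
      have "vN (Suc k) (\<lambda>x. y \<epsilon> x - y 0 x) \<le> K * (vN k ?g + norm (B \<epsilon> (\<lambda>x. y \<epsilon> x - y 0 x)))"
        using elim(2) vW_residual[OF dA df y0k] d sol by blast
      also have "B \<epsilon> (\<lambda>x. y \<epsilon> x - y 0 x) = c \<epsilon> - B \<epsilon> (y 0)"
        using bounded_linear_W_diff[OF Bb[OF \<epsilon>] y(1) y0(1)] y(3) by simp
      also have "K * (vN k ?g + norm (c \<epsilon> - B \<epsilon> (y 0))) \<le> bound \<epsilon>"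
      proof -
        have "vN k ?g \<le> vN k (\<lambda>x. f \<epsilon> x - f 0 x) + vN k (\<lambda>x. (A \<epsilon> x - A 0 x) *v y 0 x)"
          by (rule vW_N_diff(2)[OF df vW_N_matvec(1)[OF dA y0k]])
        also have "vN k (\<lambda>x. (A \<epsilon> x - A 0 x) *v y 0 x) \<le> 2 ^ k * mN k (\<lambda>x. A \<epsilon> x - A 0 x) * vN k (y 0)"
          by (rule vW_N_matvec(2)[OF dA y0k])
        finally show ?thesis unfolding bound_def by (intro mult_left_mono[OF _ K(1)]) simp
      qed
      finally show ?case using vN_nonneg[OF d] by simp
    qed
  qed
  show ?thesis
    unfolding nk diff_Suc_1 using inv ex conv by blast
qed

end
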